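(* Let $n\in\mathbb{N}$ and let $T\in\mathfrak{L}(n)$, written as $T=\sum_{\alpha\in\mathbb{N}_0^n}q_\alpha(\mathbf{x})\partial^\alpha$ with $q_\alpha\in\mathbb{R}[x_1,\ldots,x_n]$, $\alpha\in\mathbb{N}_0^n$. The following assertions are equivalent: (1) $T(\overline{POS}(n))\subseteq\overline{POS}(n)$; (2) $T_{\mathbf{y}}(\overline{POS}(n))\subseteq\overline{POS}(n)$ for all $\mathbf{y}\in\mathbb{R}^n$; (3) $\langle p_{\mathbf{y},2\alpha},f\rangle\ge 0$ for all $\mathbf{y}\in\mathbb{R}^n$, $\alpha\in\mathbb{N}_0^n$, $f\in\overline{POS}(n)_{2\alpha}$, i.e., $p_{\mathbf{y},2\alpha}\in\overline{POS}(n)_{2\alpha}^*$; (4) For any $\mathbf{s}=(s_1,\ldots,s_n)\in\mathbb{R}^n$ there exists $\mu_{\mathbf{s}}\in\mathfrak{M}_n^+$ such that, for every $\alpha\in\mathbb{N}_0^n$, $\int\mathbf{t}^\alpha\,d\mu_{\mathbf{s}}(\mathbf{t})$ is a polynomial in $s_1,\ldots,s_n$ with real coefficients, and $\mathcal{H}_{\mathbf{y}}(\alpha)=\int\mathbf{t}^\alpha\,d\mu_{\mathbf{y}}(\mathbf{t})$ for all $\mathbf{y}\in\mathbb{R}^n$, $\alpha\in\mathbb{N}_0^n$. The family of operators $\{T_{\mathbf{y}}\}_{\mathbf{y}\in\mathbb{R}^n}$ is then given by the convolutions $$T_{\mathbf{y}}(f)(\mathbf{x})=\int f(\mathbf{t}+\mathbf{x})\,d\mu_{\mathbf{y}}(\mathbf{t}),\quad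 f\in\mathbb{R}[x_1,\ldots,x_n],\ \mathbf{y}\in\mathbb{R}^n.$$ Furthermore, each of these conditions implies: (5) The map $\mathcal{H}_{\mathbf{y}}:\mathbb{N}_0^n\to\mathbb{R}$ is a positive semidefinite kernel on $\mathbb{N}_0^n\times\mathbb{N}_0^n$ for each $\mathbf{y}\in\mathbb{R}^n$, i.e., the Hankel matrix $\big(\mathcal{H}_{\mathbf{y}}(\alpha^i+\alpha^j)\big)_{i,j=1}^m$ is positive semidefinite for any $m\in\mathbb{N}$ and $\{\alpha^1,\ldots,\alpha^m\}\subset\mathbb{N}_0^n$.
   Context: $\mathbb{N}_0$ is the set of non-negative integers. For $\alpha=(\alpha_1,\ldots,\alpha_n)\in\mathbb{N}_0^n$ and $\mathbf{x}=(x_1,\ldots,x_n)$: $\mathbf{x}^\alpha=x_1^{\alpha_1}\cdots x_n^{\alpha_n}$, $\alpha!=\alpha_1!\cdots\alpha_n!$, $2\alpha=(2\alpha_1,\ldots,2\alpha_n)$, $\partial^\alpha=\partial_{x_1}^{\alpha_1}\cdots\partial_{x_n}^{\alpha_n}$ with $\partial_{x_i}=\partial/\partial x_i$; $\beta\le\alpha$ means $\beta_i\le\alpha_i$ for all $i$. $\mathbb{R}_\alpha[x_1,\ldots,x_n]=\{p\in\mathbb{R}[x_1,\ldots,x_n]:\deg_{x_i}(p)\le\alpha_i,\ 1\le i\le n\}$. $\overline{POS}(n)=\{p\in\mathbb{R}[x_1,\ldots,x_n]:p(\mathbf{x})\ge0 \text{ for all } \mathbf{x}\in\mathbb{R}^n\}$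 and $\overline{POS}(n)_\alpha=\overline{POS}(n)\cap\mathbb{R}_\alpha[x_1,\ldots,x_n]$. $\mathfrak{L}(n)$ is the space of all linear operators $T:\mathbb{R}[x_1,\ldots,x_n]\to\mathbb{R}[x_1,\ldots,x_n]$. Any $T\in\mathfrak{L}(n)$ is uniquely represented as an (a priori infinite order) linear partial differential operator $T=\sum_{\alpha\in\mathbb{N}_0^n}q_\alpha(\mathbf{x})\partial^\alpha$ with $q_\alpha\in\mathbb{R}[x_1,\ldots,x_n]$. For fixed $\mathbf{y}\in\mathbb{R}^n$ and $\alpha\in\mathbb{N}_0^n$ define $$T_{\mathbf{y}}=\sum_{\alpha\in\mathbb{N}_0^n}q_\alpha(\mathbf{y})\partial^\alpha\in\mathfrak{L}(n),\qquad p_{\mathbf{y},\alpha}(\mathbf{x})=\sum_{\beta\le\alpha}q_\beta(\mathbf{y})\mathbf{x}^\beta,\qquad \mathcal{H}_{\mathbf{y}}(\alpha)=\alpha!\,q_\alpha(\mathbf{y}).$$ The inner product on $\mathbb{R}[x_1,\ldots,x_n]$ is the Fischer-Fock one: $\langle\sum_\alpha a_\alpha\mathbf{x}^\alpha,\sum_\alpha b_\alpha\mathbf{x}^\alpha\rangle=\sum_\alpha\alpha!\,a_\alpha b_\alpha$. For a cone $K\subseteq\mathbb{R}[x_1,\ldots,x_n]$, $K^*=\{f\in\mathbb{R}[x_1,\ldots,x_n]:\langle f,g\rangle\ge0 \text{ for all } g\in K\}$. $\mathfrak{M}_n^+$ is the class of non-negative measures $\mu$ on $\mathbb{R}^n$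 with all moments finite, i.e. $\int|\mathbf{t}^\alpha|\,d\mu(\mathbf{t})<\infty$ for all $\alpha\in\mathbb{N}_0^n$. *)

theory Defs
  imports "HOL-Analysis.Analysis" "HOL-Library.Poly_Mapping"
begin

text \<open>
  Multi-indices are vectors \<open>nat ^ 'n\<close> and points are vectors \<open>real ^ 'n\<close>, where \<open>n = CARD('n) \<ge> 1\<close>.
  The order \<open>\<le>\<close> on multi-indices is the componentwise one. A polynomial is the
  finitely supported family of its coefficients.
\<close>

type_synonym 'n mpoly = "(nat ^ 'n) \<Rightarrow>\<^sub>0 real"

definition mpow :: "real ^ 'n::finite \<Rightarrow> nat ^ 'n \<Rightarrow> real" where
  "mpow x \<alpha> = (\<Prod>i\<in>UNIV. (x $ i) ^ (\<alpha> $ i))"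

definition mfact :: "nat ^ 'n::finite \<Rightarrow> real" where
  "mfact \<alpha> = (\<Prod>i\<in>UNIV. fact (\<alpha> $ i))"

definition peval :: "'n::finite mpoly \<Rightarrow> real ^ 'n \<Rightarrow> real" where
  "peval p x = (\<Sum>\<alpha>\<in>Poly_Mapping.keys p. Poly_Mapping.lookup p \<alpha> * mpow x \<alpha>)"

definition const :: "real \<Rightarrow> 'n::finite mpoly" where
  "const c = Poly_Mapping.single 0 c"

abbreviation linear_operator :: "('n::finite mpoly \<Rightarrow> 'n mpoly) \<Rightarrow> bool" where
  "linear_operator \<equiv> Vector_Spaces.linear (\<lambda>c p. const c * p) (\<lambda>c p. const c * p)"

text \<open>In \<open>pd\<close>, the truncated subtraction is harmless: if \<open>\<alpha> $ i = 0\<close>, the coefficient vanishes.\<close>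

definition pd :: "'n::finite \<Rightarrow> 'n mpoly \<Rightarrow> 'n mpoly" where
  "pd i p = (\<Sum>\<alpha>\<in>Poly_Mapping.keys p.
     Poly_Mapping.single (\<alpha> - axis i 1) (real (\<alpha> $ i) * Poly_Mapping.lookup p \<alpha>))"

text \<open>The composition of the powers \<open>pd i ^^ (\<alpha> $ i)\<close> over all variables; the order of
  composition is irrelevant by \<open>pd_commute\<close> below.\<close>

definition pderivs :: "nat ^ 'n::finite \<Rightarrow> 'n mpoly \<Rightarrow> 'n mpoly" where
  "pderivs \<alpha> p = Finite_Set.fold (\<lambda>i. pd i ^^ (\<alpha> $ i)) p UNIV"

text \<open>The a priori infinite order operator with coefficients \<open>q\<close>. Applied to a polynomial, only
  finitely many summands are nonzero (\<open>finite_diff_op\<close> below), and \<open>Sum_any\<close> adds up these.\<close>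

definition diff_op :: "(nat ^ 'n::finite \<Rightarrow> 'n mpoly) \<Rightarrow> 'n mpoly \<Rightarrow> 'n mpoly" where
  "diff_op q p = Sum_any (\<lambda>\<alpha>. q \<alpha> * pderivs \<alpha> p)"

text \<open>\<open>T\<^sub>y\<close>, \<open>p\<^bsub>y,\<alpha>\<^esub>\<close> and \<open>H\<^sub>y\<close> for the operator with coefficients \<open>q\<close>.\<close>

definition frozen_op :: "(nat ^ 'n::finite \<Rightarrow> 'n mpoly) \<Rightarrow> real ^ 'n \<Rightarrow> 'n mpoly \<Rightarrow> 'n mpoly" where
  "frozen_op q y = diff_op (\<lambda>\<alpha>. const (peval (q \<alpha>) y))"

definition symbol_trunc :: "(nat ^ 'n::finite \<Rightarrow> 'n mpoly) \<Rightarrow> real ^ 'n \<Rightarrow> nat ^ 'n \<Rightarrow> 'n mpoly" where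
  "symbol_trunc q y \<alpha> = (\<Sum>\<beta>\<in>{..\<alpha>}. Poly_Mapping.single \<beta> (peval (q \<beta>) y))"

definition hankel :: "(nat ^ 'n::finite \<Rightarrow> 'n mpoly) \<Rightarrow> real ^ 'n \<Rightarrow> nat ^ 'n \<Rightarrow> real" where
  "hankel q y \<alpha> = mfact \<alpha> * peval (q \<alpha>) y"

definition POS :: "'n::finite mpoly set" where
  "POS = {p. \<forall>x. 0 \<le> peval p x}"

text \<open>The zero polynomial gets degree 0, which is immaterial for upper bounds on the degree.\<close>

definition deg_in :: "'n::finite \<Rightarrow> 'n mpoly \<Rightarrow> nat" where
  "deg_in i p = Max (insert 0 ((\<lambda>\<alpha>. \<alpha> $ i) ` Poly_Mapping.keys p))"

definition bounded_deg :: "nat ^ 'n::finite \<Rightarrow> 'n mpoly set" where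
  "bounded_deg \<alpha> = {p. \<forall>i. deg_in i p \<le> \<alpha> $ i}"

definition POS_deg :: "nat ^ 'n::finite \<Rightarrow> 'n mpoly set" where
  "POS_deg \<alpha> = POS \<inter> bounded_deg \<alpha>"

definition fischer :: "'n::finite mpoly \<Rightarrow> 'n mpoly \<Rightarrow> real" where
  "fischer f g = (\<Sum>\<alpha>\<in>Poly_Mapping.keys f \<union> Poly_Mapping.keys g.
     mfact \<alpha> * Poly_Mapping.lookup f \<alpha> * Poly_Mapping.lookup g \<alpha>)"

definition dual_cone :: "'n::finite mpoly set \<Rightarrow> 'n mpoly set" where
  "dual_cone K = {f. \<forall>g\<in>K. 0 \<le> fischer f g}"

definition moment_measures :: "(real ^ 'n::finite) measure set" where
  "moment_measures = {M. sets M = sets borel \<and>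
     (\<forall>\<alpha>. (\<integral>\<^sup>+ t. ennreal \<bar>mpow t \<alpha>\<bar> \<partial>M) < \<infinity>)}"

definition moment_family ::
  "(nat ^ 'n::finite \<Rightarrow> 'n mpoly) \<Rightarrow> (real ^ 'n \<Rightarrow> (real ^ 'n) measure) \<Rightarrow> bool" where
  "moment_family q \<mu> \<longleftrightarrow>
     (\<forall>s. \<mu> s \<in> moment_measures) \<and>
     (\<forall>\<alpha>. \<exists>P :: 'n mpoly. \<forall>s. (\<integral>t. mpow t \<alpha> \<partial>(\<mu> s)) = peval P s) \<and>
     (\<forall>y \<alpha>. hankel q y \<alpha> = (\<integral>t. mpow t \<alpha> \<partial>(\<mu> y)))"

definition psd_matrix :: "nat \<Rightarrow> (nat \<Rightarrow> nat \<Rightarrow> real) \<Rightarrow> bool" where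
  "psd_matrix m A \<longleftrightarrow> (\<forall>i\<in>{1..m}. \<forall>j\<in>{1..m}. A i j = A j i) \<and>
     (\<forall>v :: nat \<Rightarrow> real. 0 \<le> (\<Sum>i=1..m. \<Sum>j=1..m. v i * A i j * v j))"

definition psd_hankel_kernel :: "(nat ^ 'n::finite \<Rightarrow> real) \<Rightarrow> bool" where
  "psd_hankel_kernel h \<longleftrightarrow>
     (\<forall>m. \<forall>\<alpha> :: nat \<Rightarrow> nat ^ 'n. psd_matrix m (\<lambda>i j. h (\<alpha> i + \<alpha> j)))"

lemma finite_atMost_multiindex: "finite {..\<alpha> :: nat ^ 'n::finite}"
proof -
  have "{..\<alpha>} \<subseteq> (\<lambda>f. \<chi> i. f i) ` (\<Pi>\<^sub>E i\<in>UNIV. {..\<alpha> $ i})"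
  proof
    fix \<beta> assume "\<beta> \<in> {..\<alpha>}"
    then have "($) \<beta> \<in> (\<Pi>\<^sub>E i\<in>UNIV. {..\<alpha> $ i})"
      by (auto simp: less_eq_vec_def)
    moreover have "\<beta> = (\<chi> i. \<beta> $ i)" by (simp add: vec_eq_iff)
    ultimately show "\<beta> \<in> (\<lambda>f. \<chi> i. f i) ` (\<Pi>\<^sub>E i\<in>UNIV. {..\<alpha> $ i})" by blast
  qed
  then show ?thesis by (rule finite_subset) (auto intro!: finite_PiE)
qed

lemma vector_space_mpoly:
  "vector_space (\<lambda>c (p :: 'n::finite mpoly). const c * p)"
proof unfold_locales
  show "const 1 * p = p" for p :: "'n mpoly"
    by (simp add: const_def)
qed (simp_all add: const_def algebra_simps single_add mult_single flip: mult.assoc)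

lemma lookup_pd:
  "Poly_Mapping.lookup (pd i p) \<beta> =
     real (Suc (\<beta> $ i)) * Poly_Mapping.lookup p (\<beta> + axis i 1)"
proof -
  have eq: "\<alpha> - axis i 1 = \<beta> \<longleftrightarrow> \<alpha> = \<beta> + axis i 1" if "\<alpha> $ i \<noteq> 0" for \<alpha> :: "nat ^ 'a"
    using that by (auto simp: vec_eq_iff axis_def)
  have "Poly_Mapping.lookup (pd i p) \<beta> =
      (\<Sum>\<alpha>\<in>Poly_Mapping.keys p. if \<alpha> = \<beta> + axis i 1
         then real (Suc (\<beta> $ i)) * Poly_Mapping.lookup p (\<beta> + axis i 1) else 0)"
    unfolding pd_def lookup_sum
  proof (rule sum.cong[OF refl])
    fix \<alpha>
    show "Poly_Mapping.lookup (Poly_Mapping.single (\<alpha> - axis i 1)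
            (real (\<alpha> $ i) * Poly_Mapping.lookup p \<alpha>)) \<beta> =
          (if \<alpha> = \<beta> + axis i 1
           then real (Suc (\<beta> $ i)) * Poly_Mapping.lookup p (\<beta> + axis i 1) else 0)"
    proof (cases "\<alpha> $ i = 0")
      case True
      then have "\<alpha> \<noteq> \<beta> + axis i 1" by (auto simp: axis_def)
      with True show ?thesis by simp
    next
      case False
      then show ?thesis using eq[OF False] by (auto simp: lookup_single when_def axis_def)
    qed
  qed
  then show ?thesis by (simp add: in_keys_iff)
qed

lemma pd_commute: "pd i (pd j p) = pd j (pd i p)"
  by (rule poly_mapping_eqI) (auto simp: lookup_pd axis_def add.assoc add.commute add.left_commute)

lemma comp_fun_commute_pd: "comp_fun_commute (\<lambda>i. pd i ^^ (\<alpha> $ i))"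
proof
  have *: "pd i ((pd j ^^ b) p) = (pd j ^^ b) (pd i p)" for i j b and p :: "'a mpoly"
    by (induction b) (simp_all, metis pd_commute)
  have "(pd i ^^ a) ((pd j ^^ b) p) = (pd j ^^ b) ((pd i ^^ a) p)" for i j a b and p :: "'a mpoly"
    by (induction a) (auto simp: *)
  then show "pd j ^^ (\<alpha> $ j) \<circ> pd i ^^ (\<alpha> $ i) = pd i ^^ (\<alpha> $ i) \<circ> pd j ^^ (\<alpha> $ j)" for i j
    by (auto simp: fun_eq_iff)
qed

lemma lookup_pd_power:
  "Poly_Mapping.lookup ((pd i ^^ k) p) \<beta> =
     fact (\<beta> $ i + k) / fact (\<beta> $ i) * Poly_Mapping.lookup p (\<beta> + axis i k)"
proof (induction k arbitrary: \<beta>)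
  case 0
  have "axis i 0 = (0 :: nat ^ 'a)" by (simp add: axis_def vec_eq_iff)
  then show ?case by (simp del: axis_eq_0_iff)
next
  case (Suc k)
  have "axis i 1 + axis i k = (axis i (Suc k) :: nat ^ 'a)" by (simp add: axis_def vec_eq_iff)
  moreover have "(\<beta> + axis i 1) $ i = Suc (\<beta> $ i)" by (simp add: axis_def)
  ultimately show ?case by (simp add: lookup_pd Suc.IH add.assoc)
qed

lemma lookup_pderivs:
  "Poly_Mapping.lookup (pderivs \<alpha> p) \<beta> =
     mfact (\<beta> + \<alpha>) / mfact \<beta> * Poly_Mapping.lookup p (\<beta> + \<alpha>)"
proof -
  interpret comp_fun_commute "\<lambda>i. pd i ^^ (\<alpha> $ i)" by (rule comp_fun_commute_pd)
  have "Poly_Mapping.lookup (Finite_Set.fold (\<lambda>i. pd i ^^ (\<alpha> $ i)) p A) \<beta> =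
      (\<Prod>i\<in>A. fact (\<beta> $ i + \<alpha> $ i) / fact (\<beta> $ i)) *
      Poly_Mapping.lookup p (\<chi> i. \<beta> $ i + (if i \<in> A then \<alpha> $ i else 0))" if "finite A" for A
    using that
  proof (induction A arbitrary: \<beta>)
    case empty
    then show ?case by simp
  next
    case (insert j A)
    have 1: "(\<chi> i. (\<beta> + axis j (\<alpha> $ j)) $ i + (if i \<in> A then \<alpha> $ i else 0)) =
        (\<chi> i. \<beta> $ i + (if i \<in> insert j A then \<alpha> $ i else 0))"
      using insert.hyps by (auto simp: vec_eq_iff axis_def)
    have 2: "(\<Prod>i\<in>A. fact ((\<beta> + axis j (\<alpha> $ j)) $ i + \<alpha> $ i) / fact ((\<beta> + axis j (\<alpha> $ j)) $ i)) =
        (\<Prod>i\<in>A. fact (\<beta> $ i + \<alpha> $ i) / fact (\<beta> $ i) :: real)"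
      using insert.hyps by (intro prod.cong) (auto simp: axis_def)
    show ?case
      by (simp only: fold_insert[OF insert.hyps] lookup_pd_power insert.IH 1 2
          prod.insert[OF insert.hyps] mult.assoc)
  qed
  from this[of UNIV] show ?thesis
    by (simp add: pderivs_def mfact_def prod_dividef plus_vec_def)
qed

lemma finite_diff_op: "finite {\<alpha>. q \<alpha> * pderivs \<alpha> p \<noteq> 0}"
proof -
  have "{\<alpha>. q \<alpha> * pderivs \<alpha> p \<noteq> 0} \<subseteq> (\<Union>\<gamma>\<in>Poly_Mapping.keys p. {..\<gamma>})"
  proof
    fix \<alpha> assume "\<alpha> \<in> {\<alpha>. q \<alpha> * pderivs \<alpha> p \<noteq> 0}"
    then have "pderivs \<alpha> p \<noteq> 0" by auto
    then obtain \<beta> where "Poly_Mapping.lookup (pderivs \<alpha> p) \<beta> \<noteq> 0"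
      by (metis lookup_zero poly_mapping_eqI)
    then have "\<beta> + \<alpha> \<in> Poly_Mapping.keys p" by (auto simp: lookup_pderivs in_keys_iff)
    moreover have "\<alpha> \<le> \<beta> + \<alpha>" by (simp add: less_eq_vec_def)
    ultimately show "\<alpha> \<in> (\<Union>\<gamma>\<in>Poly_Mapping.keys p. {..\<gamma>})" by auto
  qed
  then show ?thesis by (rule finite_subset) (auto simp: finite_atMost_multiindex)
qed

end

theory Submission
  imports Defs "HOL-Probability.Probability"
begin

text \<open>
  Let \<open>L\<^sub>y f = (\<Sum>\<alpha>. H\<^sub>y(\<alpha>) f\<^sub>\<alpha>) = (T\<^sub>y f)(0)\<close>. Since \<open>T\<^sub>y\<close> has constant coefficients, it commutes with
  translations, and \<open>(T f)(y) = (T\<^sub>y f)(y)\<close>; so (1) and (2) both say that every \<open>L\<^sub>y\<close> is nonnegative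
  on nonnegative polynomials, and so does (3) because the Fischer product with \<open>p\<^bsub>y,2\<alpha>\<^esub>\<close> is \<open>L\<^sub>y\<close>.
  Condition (4) is then Haviland's theorem. To prove it, a normalised \<open>L\<close> is approximated on finitely
  many monomials by finitely supported probability measures. These are lifted to the real line along
  a continuous surjection from the line onto the space under which bounded sets lift to bounded sets.
  The lifts are tight, Helly's selection theorem gives a weak limit, and its image represents \<open>L\<close>
  because convergence of the moments of doubled degree makes the monomials uniformly integrable.
\<close>

subsection \<open>Riesz functionals and the Taylor shift\<close>

text \<open>Point evaluation is the case \<open>h = mpow x\<close>, and integration the case where
  \<open>h\<close> lists the moments of a measure.\<close>

definition riesz :: "(nat ^ 'n::finite \<Rightarrow> real) \<Rightarrow> 'n mpoly \<Rightarrow> real" where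
  "riesz h p = (\<Sum>\<alpha>\<in>Poly_Mapping.keys p. Poly_Mapping.lookup p \<alpha> * h \<alpha>)"

lemma peval_eq_riesz: "peval p x = riesz (mpow x) p"
  by (simp add: peval_def riesz_def)

lemma riesz_superset:
  assumes "finite A" "Poly_Mapping.keys p \<subseteq> A"
  shows "riesz h p = (\<Sum>\<alpha>\<in>A. Poly_Mapping.lookup p \<alpha> * h \<alpha>)"
  unfolding riesz_def using assms by (intro sum.mono_neutral_left) (auto simp: in_keys_iff)

lemma riesz_zero [simp]: "riesz h 0 = 0"
  by (simp add: riesz_def)

lemma riesz_add: "riesz h (p + p') = riesz h p + riesz h p'"
proof -
  let ?A = "Poly_Mapping.keys p \<union> Poly_Mapping.keys p'"
  have "Poly_Mapping.keys (p + p') \<subseteq> ?A" by (rule keys_add)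
  then show ?thesis
    by (simp add: riesz_superset[of ?A] lookup_add sum.distrib distrib_right)
qed

lemma riesz_sum: "riesz h (sum f A) = (\<Sum>a\<in>A. riesz h (f a))"
  by (induction A rule: infinite_finite_induct) (simp_all add: riesz_add)

lemma riesz_single [simp]: "riesz h (Poly_Mapping.single \<alpha> c) = c * h \<alpha>"
  by (simp add: riesz_def)

lemma riesz_one [simp]: "riesz h 1 = h 0"
  using riesz_single[of h 0 1] by simp

lemma riesz_cmult: "riesz (\<lambda>\<alpha>. c * h \<alpha>) p = c * riesz h p"
  by (simp add: riesz_def sum_distrib_left mult.left_commute)

lemma sum_singles: "(\<Sum>\<alpha>\<in>Poly_Mapping.keys p. Poly_Mapping.single \<alpha> (Poly_Mapping.lookup p \<alpha>)) = p"
  by (rule poly_mapping_eqI) (auto simp: lookup_sum lookup_single when_def in_keys_iff)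

section \<open>Monomials, evaluation and derivatives\<close>

lemma mpow_0_right [simp]: "mpow x 0 = 1"
  by (simp add: mpow_def)

lemma mpow_0_left: "mpow 0 \<alpha> = (if \<alpha> = 0 then 1 else 0)"
proof (cases "\<alpha> = 0")
  case False
  then obtain i where "\<alpha> $ i \<noteq> 0" by (auto simp: vec_eq_iff)
  then show ?thesis using False by (auto simp: mpow_def intro!: exI[of _ i])
qed simp

lemma mpow_add: "mpow x (\<alpha> + \<beta>) = mpow x \<alpha> * mpow x \<beta>"
  by (simp add: mpow_def power_add prod.distrib)

lemma mpow_axis: "mpow x (axis i k) = (x $ i) ^ k"
proof -
  have "mpow x (axis i k) = (\<Prod>j\<in>UNIV. if j = i then (x $ i) ^ k else 1)"
    unfolding mpow_def by (intro prod.cong) (auto simp: axis_def)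
  then show ?thesis by simp
qed

lemma peval_mult: "peval (p * p') x = peval p x * peval p' x"
proof -
  let ?s = "\<lambda>p. \<Sum>\<alpha>\<in>Poly_Mapping.keys p. Poly_Mapping.single \<alpha> (Poly_Mapping.lookup p \<alpha>)"
  have "peval (?s p * ?s p') x = peval (?s p) x * peval (?s p') x"
    by (simp add: peval_eq_riesz sum_product riesz_sum mult_single mpow_add mult_ac)
  then show ?thesis by (simp only: sum_singles)
qed

lemma peval_sum: "peval (sum f A) x = (\<Sum>a\<in>A. peval (f a) x)"
  by (simp add: peval_eq_riesz riesz_sum)

lemma peval_single [simp]: "peval (Poly_Mapping.single \<alpha> c) x = c * mpow x \<alpha>"
  by (simp add: peval_eq_riesz)

lemma peval_const [simp]: "peval (const c) x = c"
  by (simp add: const_def)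

lemma mfact_pos [simp]: "mfact \<alpha> > 0"
  by (simp add: mfact_def prod_pos)

lemma mfact_nonzero [simp]: "mfact \<alpha> \<noteq> 0"
  using mfact_pos[of \<alpha>] by linarith

lemma mfact_0 [simp]: "mfact 0 = 1"
  by (simp add: mfact_def)

lemma pderivs_add: "pderivs \<alpha> (pderivs \<beta> p) = pderivs (\<beta> + \<alpha>) p"
  by (rule poly_mapping_eqI) (simp add: lookup_pderivs add_ac)

lemma pderivs_sum: "pderivs \<alpha> (sum f A) = (\<Sum>a\<in>A. pderivs \<alpha> (f a))"
  by (rule poly_mapping_eqI) (simp add: lookup_pderivs lookup_sum sum_distrib_left)

lemma pderivs_single:
  "pderivs \<alpha> (Poly_Mapping.single \<gamma> c) =
     (if \<alpha> \<le> \<gamma> then Poly_Mapping.single (\<gamma> - \<alpha>) (mfact \<gamma> / mfact (\<gamma> - \<alpha>) * c) else 0)"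
proof (rule poly_mapping_eqI)
  fix \<beta>
  have "n = b + a \<longleftrightarrow> a \<le> n \<and> n - a = b" for n a b :: nat by auto
  then have "\<gamma> = \<beta> + \<alpha> \<longleftrightarrow> \<alpha> \<le> \<gamma> \<and> \<gamma> - \<alpha> = \<beta>"
    by (simp add: vec_eq_iff less_eq_vec_def all_conj_distrib)
  then show "Poly_Mapping.lookup (pderivs \<alpha> (Poly_Mapping.single \<gamma> c)) \<beta> =
      Poly_Mapping.lookup (if \<alpha> \<le> \<gamma> then Poly_Mapping.single (\<gamma> - \<alpha>) (mfact \<gamma> / mfact (\<gamma> - \<alpha>) * c) else 0) \<beta>"
    by (auto simp: lookup_pderivs lookup_single when_def)
qed

text \<open>This accounts for the factor \<open>mfact \<alpha>\<close> in \<open>hankel\<close>: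
  evaluating \<open>T\<^sub>y f\<close> at the origin pairs \<open>hankel q y\<close> with the
  coefficients of \<open>f\<close>.\<close>

lemma peval_pderivs_0: "peval (pderivs \<alpha> f) 0 = mfact \<alpha> * Poly_Mapping.lookup f \<alpha>"
proof -
  have "peval p 0 = Poly_Mapping.lookup p 0" for p :: "'a mpoly"
  proof -
    have "peval p 0 = (\<Sum>\<beta>\<in>Poly_Mapping.keys p. if \<beta> = 0 then Poly_Mapping.lookup p 0 else 0)"
      unfolding peval_def by (intro sum.cong) (auto simp: mpow_0_left)
    then show ?thesis by (simp add: in_keys_iff)
  qed
  then show ?thesis by (simp add: lookup_pderivs)
qed

section \<open>Taylor shifts\<close>

definition below :: "'n::finite mpoly \<Rightarrow> (nat ^ 'n) set" where
  "below p = (\<Union>\<gamma>\<in>Poly_Mapping.keys p. {..\<gamma>})"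

lemma finite_below [simp]: "finite (below p)"
  by (simp add: below_def finite_atMost_multiindex)

lemma keys_subset_below: "Poly_Mapping.keys p \<subseteq> below p"
  by (auto simp: below_def)

text \<open>Differentiation of order \<open>\<alpha>\<close> annihilates every monomial whose
  exponent is not above \<open>\<alpha>\<close>. Hence the finite set \<open>below p\<close> can
  index all sums over derivatives of \<open>p\<close>.\<close>

lemma pderivs_outside_below:
  assumes "\<alpha> \<notin> below p"
  shows "pderivs \<alpha> p = 0"
proof (rule poly_mapping_eqI)
  fix \<beta>
  have "\<alpha> \<le> \<beta> + \<alpha>" by (simp add: less_eq_vec_def)
  then have "\<beta> + \<alpha> \<notin> Poly_Mapping.keys p" using assms by (auto simp: below_def)
  then show "Poly_Mapping.lookup (pderivs \<alpha> p) \<beta> = Poly_Mapping.lookup 0 \<beta>"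
    by (simp add: lookup_pderivs in_keys_iff)
qed

text \<open>Any finite superset is allowed as index set, so that a polynomial and its shift can be
  summed over the same set.\<close>

lemma peval_diff_op:
  assumes "finite A" "below p \<subseteq> A"
  shows "peval (diff_op q p) x = (\<Sum>\<alpha>\<in>A. peval (q \<alpha>) x * peval (pderivs \<alpha> p) x)"
proof -
  have "{\<alpha>. q \<alpha> * pderivs \<alpha> p \<noteq> 0} \<subseteq> A"
  proof
    fix \<alpha> assume "\<alpha> \<in> {\<alpha>. q \<alpha> * pderivs \<alpha> p \<noteq> 0}"
    then have "pderivs \<alpha> p \<noteq> 0" by auto
    then show "\<alpha> \<in> A" using pderivs_outside_below assms(2) by blast
  qed
  then have "diff_op q p = (\<Sum>\<alpha>\<in>A. q \<alpha> * pderivs \<alpha> p)"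
    unfolding diff_op_def using assms(1) by (rule Sum_any.expand_superset[rotated])
  then show ?thesis by (simp add: peval_sum peval_mult)
qed

text \<open>Translation by \<open>c\<close>, given by Taylor coefficients instead of substitution:
  these are the derivatives that occur in a differential operator.\<close>

definition taylor :: "real ^ 'n \<Rightarrow> 'n::finite mpoly \<Rightarrow> 'n mpoly" where
  "taylor c p = (\<Sum>\<alpha>\<in>below p. Poly_Mapping.single \<alpha> (peval (pderivs \<alpha> p) c / mfact \<alpha>))"

lemma lookup_taylor: "Poly_Mapping.lookup (taylor c p) \<alpha> = peval (pderivs \<alpha> p) c / mfact \<alpha>"
proof (cases "\<alpha> \<in> below p")
  case True
  then show ?thesis
    by (simp add: taylor_def lookup_sum lookup_single when_def)
next
  case False
  then show ?thesis
    by (auto simp: taylor_def lookup_sum lookup_single when_def pderivs_outside_below peval_eq_riesz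
        intro!: sum.neutral)
qed

lemma keys_taylor: "Poly_Mapping.keys (taylor c p) \<subseteq> below p"
proof
  fix \<alpha> assume "\<alpha> \<in> Poly_Mapping.keys (taylor c p)"
  then have "pderivs \<alpha> p \<noteq> 0" by (auto simp: in_keys_iff lookup_taylor peval_eq_riesz)
  then show "\<alpha> \<in> below p" using pderivs_outside_below by blast
qed

lemma mpow_binomial:
  "mpow (x + c) \<gamma> = (\<Sum>\<alpha>\<in>{..\<gamma>}. mfact \<gamma> / (mfact \<alpha> * mfact (\<gamma> - \<alpha>)) * mpow c (\<gamma> - \<alpha>) * mpow x \<alpha>)"
proof -
  let ?t = "\<lambda>i k. fact (\<gamma> $ i) / (fact k * fact (\<gamma> $ i - k)) * (c $ i) ^ (\<gamma> $ i - k) * (x $ i) ^ k :: real"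
  have "mpow (x + c) \<gamma> = (\<Prod>i\<in>UNIV. \<Sum>k\<le>\<gamma> $ i. ?t i k)"
    unfolding mpow_def
    by (intro prod.cong refl)
       (simp add: binomial_ring binomial_fact mult_ac)
  \<comment> \<open>Distributivity: choosing one summand per coordinate amounts to choosing a
    multi-index below \<open>\<gamma>\<close>.\<close>
  also have "\<dots> = (\<Sum>g\<in>(\<Pi>\<^sub>E i\<in>UNIV. {..\<gamma> $ i}). \<Prod>i\<in>UNIV. ?t i (g i))"
    by (rule prod_sum_PiE) auto
  also have "\<dots> = (\<Sum>\<alpha>\<in>{..\<gamma>}. \<Prod>i\<in>UNIV. ?t i (\<alpha> $ i))"
    by (rule sum.reindex_bij_witness[where i = "($)" and j = vec_lambda])
       (auto simp: less_eq_vec_def PiE_def)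
  also have "\<dots> = (\<Sum>\<alpha>\<in>{..\<gamma>}. mfact \<gamma> / (mfact \<alpha> * mfact (\<gamma> - \<alpha>)) * mpow c (\<gamma> - \<alpha>) * mpow x \<alpha>)"
    by (simp add: mfact_def mpow_def prod.distrib prod_dividef)
  finally show ?thesis .
qed

text \<open>By linearity in \<open>p\<close> only monomials matter, and for them this is the
  binomial theorem \<open>mpow_binomial\<close>.\<close>

lemma peval_taylor: "peval (taylor c p) x = peval p (x + c)"
proof -
  have "peval (taylor c p) x = (\<Sum>\<alpha>\<in>below p. peval (pderivs \<alpha> p) c / mfact \<alpha> * mpow x \<alpha>)"
    by (simp add: taylor_def peval_sum)
  also have "\<dots> = (\<Sum>\<alpha>\<in>below p. \<Sum>\<gamma>\<in>Poly_Mapping.keys p.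
      peval (pderivs \<alpha> (Poly_Mapping.single \<gamma> (Poly_Mapping.lookup p \<gamma>))) c / mfact \<alpha> * mpow x \<alpha>)"
  proof (rule sum.cong[OF refl])
    fix \<alpha>
    have "peval (pderivs \<alpha> p) c = peval (pderivs \<alpha>
        (\<Sum>\<gamma>\<in>Poly_Mapping.keys p. Poly_Mapping.single \<gamma> (Poly_Mapping.lookup p \<gamma>))) c"
      by (simp only: sum_singles)
    then show "peval (pderivs \<alpha> p) c / mfact \<alpha> * mpow x \<alpha> = (\<Sum>\<gamma>\<in>Poly_Mapping.keys p.
      peval (pderivs \<alpha> (Poly_Mapping.single \<gamma> (Poly_Mapping.lookup p \<gamma>))) c / mfact \<alpha> * mpow x \<alpha>)"
      by (simp add: pderivs_sum peval_sum sum_divide_distrib sum_distrib_right)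
  qed
  also have "\<dots> = (\<Sum>\<gamma>\<in>Poly_Mapping.keys p. \<Sum>\<alpha>\<in>below p.
      peval (pderivs \<alpha> (Poly_Mapping.single \<gamma> (Poly_Mapping.lookup p \<gamma>))) c / mfact \<alpha> * mpow x \<alpha>)"
    by (rule sum.swap)
  \<comment> \<open>The derivative of order \<open>\<alpha>\<close> of a monomial with exponent
    \<open>\<gamma>\<close> vanishes unless \<open>\<alpha> \<le> \<gamma>\<close>.\<close>
  also have "\<dots> = (\<Sum>\<gamma>\<in>Poly_Mapping.keys p. \<Sum>\<alpha>\<in>{..\<gamma>}.
      peval (pderivs \<alpha> (Poly_Mapping.single \<gamma> (Poly_Mapping.lookup p \<gamma>))) c / mfact \<alpha> * mpow x \<alpha>)"
    by (intro sum.cong refl sum.mono_neutral_right)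
       (auto simp: below_def pderivs_single peval_eq_riesz finite_atMost_multiindex)
  also have "\<dots> = peval p (x + c)"
    unfolding peval_def mpow_binomial sum_distrib_left
    by (intro sum.cong refl) (auto simp: pderivs_single mult_ac)
  finally show ?thesis .
qed

lemma taylor_in_POS: "p \<in> POS \<Longrightarrow> taylor c p \<in> POS"
  by (simp add: POS_def peval_taylor)

text \<open>At \<open>\<beta>\<close>, both sides have the coefficient
  \<open>peval (pderivs (\<alpha> + \<beta>) p) c / mfact \<beta>\<close>.\<close>

lemma pderivs_taylor: "pderivs \<alpha> (taylor c p) = taylor c (pderivs \<alpha> p)"
  by (rule poly_mapping_eqI) (simp add: lookup_pderivs lookup_taylor pderivs_add add_ac)

text \<open>The coefficients of the shift are derivatives of \<open>f\<close> at \<open>x\<close>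
  divided by factorials, which cancel against those in \<open>hankel\<close>.\<close>

lemma peval_frozen_op:
  "peval (frozen_op q y f) x = riesz (hankel q y) (taylor x f)"
  by (simp add: frozen_op_def peval_diff_op[of "below f"] riesz_superset[OF finite_below keys_taylor]
      lookup_taylor hankel_def mult_ac)

lemma peval_diff_op_eq_frozen: "peval (diff_op q f) y = peval (frozen_op q y f) y"
  by (simp add: frozen_op_def peval_diff_op[of "below f"])

lemma peval_frozen_op_0: "peval (frozen_op q y f) 0 = riesz (hankel q y) f"
  by (simp add: frozen_op_def peval_diff_op[of "below f"] peval_pderivs_0 hankel_def
      riesz_superset[OF finite_below keys_subset_below] mult_ac)

text \<open>The coefficients are constant and translation commutes with every derivative.\<close>

lemma frozen_op_taylor: "peval (frozen_op q y (taylor c f)) x = peval (frozen_op q y f) (x + c)"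
proof -
  have "peval (frozen_op q y (taylor c f)) x =
      (\<Sum>\<alpha>\<in>below (taylor c f) \<union> below f. peval (q \<alpha>) y * peval (pderivs \<alpha> f) (x + c))"
    by (simp add: frozen_op_def peval_diff_op[of "below (taylor c f) \<union> below f"] pderivs_taylor peval_taylor)
  then show ?thesis
    by (simp add: frozen_op_def peval_diff_op[of "below (taylor c f) \<union> below f"])
qed

lemma diff_op_POS_iff:
  "diff_op q ` POS \<subseteq> POS \<longleftrightarrow> (\<forall>y. \<forall>f\<in>POS. 0 \<le> riesz (hankel q y) f)"
proof
  assume pos: "diff_op q ` POS \<subseteq> POS"
  show "\<forall>y. \<forall>f\<in>POS. 0 \<le> riesz (hankel q y) f"
  proof safe
    fix y and f :: "'a mpoly"
    assume "f \<in> POS"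
    \<comment> \<open>The shift by \<open>- y\<close> turns the value at \<open>y\<close> into the
      value of \<open>T\<^sub>y f\<close> at the origin, which is the functional at
      \<open>f\<close>.\<close>
    then have "diff_op q (taylor (- y) f) \<in> POS" using pos taylor_in_POS by blast
    then have "0 \<le> peval (diff_op q (taylor (- y) f)) y" by (simp add: POS_def)
    then show "0 \<le> riesz (hankel q y) f"
      by (simp add: peval_diff_op_eq_frozen frozen_op_taylor peval_frozen_op_0)
  qed
next
  assume "\<forall>y. \<forall>f\<in>POS. 0 \<le> riesz (hankel q y) f"
  then show "diff_op q ` POS \<subseteq> POS"
    by (auto simp: POS_def peval_diff_op_eq_frozen peval_frozen_op peval_taylor)
qed

text \<open>Evaluation at the origin gives one direction. For the other, each value is the
  functional at a shifted, still nonnegative polynomial.\<close>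

lemma frozen_op_POS_iff:
  "frozen_op q y ` POS \<subseteq> POS \<longleftrightarrow> (\<forall>f\<in>POS. 0 \<le> riesz (hankel q y) f)"
proof
  assume "frozen_op q y ` POS \<subseteq> POS"
  then have "0 \<le> peval (frozen_op q y f) 0" if "f \<in> POS" for f
    using that by (auto simp: POS_def)
  then show "\<forall>f\<in>POS. 0 \<le> riesz (hankel q y) f" by (simp add: peval_frozen_op_0)
next
  assume "\<forall>f\<in>POS. 0 \<le> riesz (hankel q y) f"
  then show "frozen_op q y ` POS \<subseteq> POS"
    by (auto simp: POS_def peval_frozen_op peval_taylor)
qed

section \<open>Degree bounds and the Fischer product\<close>

lemma bounded_deg_iff: "f \<in> bounded_deg \<alpha> \<longleftrightarrow> Poly_Mapping.keys f \<subseteq> {..\<alpha>}"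
  by (auto simp: bounded_deg_def deg_in_def less_eq_vec_def)

lemma ex_bounded_deg: "\<exists>\<alpha>. f \<in> bounded_deg (2 *s \<alpha>)"
proof -
  have "\<alpha> $ i \<le> 2 * deg_in i f" if "\<alpha> \<in> Poly_Mapping.keys f" for \<alpha> i
  proof -
    have "\<alpha> $ i \<le> deg_in i f" unfolding deg_in_def using that by (intro Max_ge) auto
    then show ?thesis by simp
  qed
  then have "f \<in> bounded_deg (2 *s (\<chi> i. deg_in i f))"
    by (auto simp: bounded_deg_iff less_eq_vec_def)
  then show ?thesis ..
qed

lemma lookup_symbol_trunc:
  "Poly_Mapping.lookup (symbol_trunc q y \<alpha>) \<beta> = (if \<beta> \<le> \<alpha> then peval (q \<beta>) y else 0)"
  by (auto simp: symbol_trunc_def lookup_sum lookup_single when_def finite_atMost_multiindex)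

text \<open>The Fischer weights turn the coefficients of the symbol into \<open>hankel q y\<close>,
  and the truncation keeps every exponent occurring in \<open>f\<close>.\<close>

lemma fischer_symbol_trunc:
  assumes "f \<in> bounded_deg \<alpha>"
  shows "fischer (symbol_trunc q y \<alpha>) f = riesz (hankel q y) f"
proof -
  have *: "Poly_Mapping.keys f \<subseteq> {..\<alpha>}" using assms by (simp add: bounded_deg_iff)
  have "Poly_Mapping.keys (symbol_trunc q y \<alpha>) \<subseteq> {..\<alpha>}"
    by (auto simp: in_keys_iff lookup_symbol_trunc split: if_splits)
  with * have "fischer (symbol_trunc q y \<alpha>) f =
      (\<Sum>\<beta>\<in>{..\<alpha>}. mfact \<beta> * Poly_Mapping.lookup (symbol_trunc q y \<alpha>) \<beta> * Poly_Mapping.lookup f \<beta>)"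
    unfolding fischer_def
    by (intro sum.mono_neutral_left finite_atMost_multiindex) (auto simp: in_keys_iff)
  also have "\<dots> = riesz (hankel q y) f"
    using * by (auto simp: riesz_superset[OF finite_atMost_multiindex] lookup_symbol_trunc hankel_def
        intro!: sum.cong)
  finally show ?thesis .
qed

lemma symbol_trunc_nonneg_iff:
  "(\<forall>\<alpha>. \<forall>f\<in>POS_deg (2 *s \<alpha>). 0 \<le> fischer (symbol_trunc q y (2 *s \<alpha>)) f) \<longleftrightarrow>
     (\<forall>f\<in>POS. 0 \<le> riesz (hankel q y) f)"
proof
  assume L: "\<forall>\<alpha>. \<forall>f\<in>POS_deg (2 *s \<alpha>). 0 \<le> fischer (symbol_trunc q y (2 *s \<alpha>)) f"
  show "\<forall>f\<in>POS. 0 \<le> riesz (hankel q y) f"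
  proof
    fix f :: "'a mpoly" assume "f \<in> POS"
    moreover obtain \<alpha> where "f \<in> bounded_deg (2 *s \<alpha>)" using ex_bounded_deg by blast
    ultimately show "0 \<le> riesz (hankel q y) f"
      using L fischer_symbol_trunc[of f "2 *s \<alpha>" q y] by (metis IntI POS_deg_def)
  qed
qed (auto simp: POS_deg_def fischer_symbol_trunc)

subsection \<open>A space-filling curve\<close>

text \<open>A continuous function of period 2 that is 0 on \<open>[0, 1/3]\<close> and 1 on
  \<open>[2/3, 1]\<close>. It thus detects the leading ternary digit of a number in the unit
  interval with digits 0 and 2.\<close>

definition digit_reader :: "real \<Rightarrow> real" where
  "digit_reader u = max 0 (min 1 (1 / 2 - cos (pi * u)))"

lemma digit_reader_bounds: "0 \<le> digit_reader u" "digit_reader u \<le> 1"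
  by (auto simp: digit_reader_def)

lemma digit_reader_add_even: "digit_reader (2 * real N + u) = digit_reader u"
proof -
  have "cos (pi * (2 * real N + u)) = cos (pi * u + 2 * real N * pi)"
    by (simp add: algebra_simps)
  also have "\<dots> = cos (pi * u)"
    by (simp only: cos_add cos_2npi sin_2npi mult_1_right mult_zero_right diff_zero)
  finally show ?thesis by (simp add: digit_reader_def)
qed

lemma digit_reader_low:
  assumes "0 \<le> u" "u \<le> 1 / 3"
  shows "digit_reader u = 0"
proof -
  have "cos (pi / 3) \<le> cos (pi * u)"
    using assms by (intro cos_monotone_0_pi_le) (auto simp: field_simps)
  then show ?thesis by (simp add: cos_60 digit_reader_def)
qed

lemma digit_reader_high:
  assumes "2 / 3 \<le> u" "u \<le> 1"
  shows "digit_reader u = 1"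
proof -
  have "cos (pi * u) \<le> cos (2 * pi / 3)"
    using assms by (intro cos_monotone_0_pi_le) (auto simp: field_simps)
  then show ?thesis by (simp add: cos_120 digit_reader_def)
qed

text \<open>Schoenberg's space-filling curve with countably many coordinates: coordinate \<open>i\<close> reads the
  ternary digits of \<open>s\<close> at the places \<open>prod_encode (i, k)\<close> as binary digits.\<close>

definition schoenberg :: "nat \<Rightarrow> real \<Rightarrow> real" where
  "schoenberg i s = suminf (\<lambda>k. (1 / 2) ^ Suc k * digit_reader (3 ^ prod_encode (i, k) * s))"

lemma continuous_schoenberg: "continuous_on UNIV (schoenberg i)"
proof -
  have s: "summable (\<lambda>k. (1 / 2 :: real) ^ Suc k)"
    using power_half_series by (rule sums_summable)
  have "uniform_limit UNIV (\<lambda>n s. \<Sum>k<n. (1 / 2) ^ Suc k * digit_reader (3 ^ prod_encode (i, k) * s))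
      (schoenberg i) sequentially"
    unfolding schoenberg_def
    by (rule Weierstrass_m_test[OF _ s]) (use digit_reader_bounds in \<open>auto simp: abs_mult\<close>)
  then show ?thesis
    by (rule uniform_limit_theorem[rotated])
       (auto intro!: always_eventually continuous_intros simp: digit_reader_def)
qed

text \<open>The dyadic truncations \<open>F n / 2 ^ n\<close> tend to \<open>z\<close>, and
  consecutive ones differ by 0 or \<open>(1 / 2) ^ Suc n\<close>. Telescoping yields the
  digits.\<close>

lemma binary_expansion:
  assumes "0 \<le> z" "z < (1::real)"
  shows "\<exists>b :: nat \<Rightarrow> bool. (\<lambda>k. (1 / 2) ^ Suc k * of_bool (b k)) sums z"
proof -
  define F where "F n = \<lfloor>2 ^ n * z\<rfloor>" for n :: nat
  have F: "F (Suc n) = 2 * F n \<or> F (Suc n) = 2 * F n + 1" for n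
    unfolding F_def by (simp only: power_Suc) linarith
  have "(\<lambda>n. real_of_int (F n) / 2 ^ n) \<longlonglongrightarrow> z"
  proof (rule real_tendsto_sandwich)
    show "\<forall>\<^sub>F n in sequentially. z - (1 / 2) ^ n \<le> real_of_int (F n) / 2 ^ n"
      unfolding F_def
    proof (intro always_eventually allI)
      fix n
      have "z - (1 / 2) ^ n = (2 ^ n * z - 1) / 2 ^ n" by (simp add: field_simps)
      also have "\<dots> \<le> real_of_int \<lfloor>2 ^ n * z\<rfloor> / 2 ^ n"
        by (intro divide_right_mono) (linarith, simp)
      finally show "z - (1 / 2) ^ n \<le> real_of_int \<lfloor>2 ^ n * z\<rfloor> / 2 ^ n" .
    qed
    show "\<forall>\<^sub>F n in sequentially. real_of_int (F n) / 2 ^ n \<le> z"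
      unfolding F_def
      by (intro always_eventually allI) (simp add: field_simps)
    have "(\<lambda>n. z - (1 / 2) ^ n) \<longlonglongrightarrow> z - 0"
      by (intro tendsto_intros LIMSEQ_power_zero) auto
    then show "(\<lambda>n. z - (1 / 2) ^ n) \<longlonglongrightarrow> z" by simp
  qed simp
  \<comment> \<open>The bounds on \<open>z\<close> give \<open>F 0 = 0\<close>, so the telescoped
    sum is \<open>z\<close> itself.\<close>
  from telescope_sums[OF this]
  have "(\<lambda>n. real_of_int (F (Suc n)) / 2 ^ Suc n - real_of_int (F n) / 2 ^ n) sums z"
    using assms floor_eq_iff[of z 0] by (simp add: F_def)
  moreover have "real_of_int (F (Suc n)) / 2 ^ Suc n - real_of_int (F n) / 2 ^ n =
      (1 / 2) ^ Suc n * of_bool (F (Suc n) \<noteq> 2 * F n)" for n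
    using F[of n] by (auto simp: field_simps)
  ultimately have "(\<lambda>n. (1 / 2) ^ Suc n * of_bool (F (Suc n) \<noteq> 2 * F n)) sums z" by (simp only:)
  then show ?thesis by (rule exI[where x = "\<lambda>n. F (Suc n) \<noteq> 2 * F n"])
qed

text \<open>Take \<open>t = T 0\<close> with ternary digits \<open>2 * of_bool (b l)\<close>.
  Multiplication by \<open>3 ^ m\<close> moves the first \<open>m\<close> digits and the summand
  \<open>2 * real j\<close> into an even integer, which periodicity discards. The remaining tail
  \<open>T m\<close> lies in the outer third selected by \<open>b m\<close>.\<close>

lemma ternary_expansion:
  fixes b :: "nat \<Rightarrow> bool"
  obtains t where "0 \<le> t" "t \<le> 1"
    "\<And>j m. digit_reader (3 ^ m * (2 * real j + t)) = of_bool (b m)"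
proof -
  define T where "T m = suminf (\<lambda>l. 2 * of_bool (b (m + l)) * (1 / 3 :: real) ^ Suc l)" for m
  have geo: "(\<lambda>l. 2 * (1 / 3 :: real) ^ Suc l) sums 1"
    using sums_mult[OF geometric_sums[of "1 / 3 :: real"], of "2 / 3"] by (simp add: mult_ac)
  have sm: "summable (\<lambda>l. 2 * of_bool (b (m + l)) * (1 / 3 :: real) ^ Suc l)" for m
    by (rule summable_comparison_test'[OF sums_summable[OF geo], of 0]) auto
  have T: "0 \<le> T m" "T m \<le> 1" for m
  proof -
    show "0 \<le> T m" unfolding T_def by (intro suminf_nonneg sm) auto
    have "T m \<le> suminf (\<lambda>l. 2 * (1 / 3 :: real) ^ Suc l)"
      unfolding T_def by (intro suminf_le sm sums_summable[OF geo]) auto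
    then show "T m \<le> 1" using sums_unique[OF geo] by simp
  qed
  have rec: "T m = (2 * of_bool (b m) + T (Suc m)) / 3" for m
  proof -
    have "T m = 2 * of_bool (b m) / 3 + suminf (\<lambda>l. 2 * of_bool (b (m + Suc l)) * (1 / 3) ^ Suc (Suc l))"
      using suminf_split_head[OF sm[of m]] by (simp add: T_def)
    also have "suminf (\<lambda>l. 2 * of_bool (b (m + Suc l)) * (1 / 3 :: real) ^ Suc (Suc l)) =
        suminf (\<lambda>l. 1 / 3 * (2 * of_bool (b (Suc m + l)) * (1 / 3) ^ Suc l))"
      by (intro arg_cong[of _ _ suminf] ext) simp
    also have "\<dots> = 1 / 3 * T (Suc m)"
      unfolding T_def by (rule suminf_mult[OF sm])
    finally show ?thesis by (simp add: field_simps)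
  qed
  have "\<exists>N. 3 ^ m * (2 * real j + T 0) = 2 * real N + T m" for j m
  proof (induction m)
    case (Suc m)
    then obtain N where "3 ^ m * (2 * real j + T 0) = 2 * real N + T m" by blast
    then have "3 ^ Suc m * (2 * real j + T 0) = 3 * (2 * real N + T m)"
      by simp
    also have "\<dots> = 2 * real (3 * N + of_bool (b m)) + T (Suc m)"
      by (simp add: rec[of m])
    finally show ?case by blast
  qed auto
  moreover have "digit_reader (T m) = of_bool (b m)" for m
    using rec[of m] T[of "Suc m"] by (cases "b m") (auto intro!: digit_reader_low digit_reader_high)
  ultimately have "digit_reader (3 ^ m * (2 * real j + T 0)) = of_bool (b m)" for j m
    by (metis digit_reader_add_even)
  with T that show thesis by blast
qed

text \<open>Distinct pairs \<open>(i, k)\<close> occupy distinct ternary places, so the binary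
  digits of all coordinates can be prescribed at once. The free \<open>j\<close> later allows a
  large parameter.\<close>

lemma schoenberg_surj:
  assumes "\<And>i. 0 \<le> z i" "\<And>i. z i < (1::real)"
  obtains t where "0 \<le> t" "t \<le> 1" "\<And>i j. schoenberg i (2 * real j + t) = z i"
proof -
  have "\<exists>b. \<forall>i. (\<lambda>k. (1 / 2) ^ Suc k * of_bool (b i k)) sums z i"
    using binary_expansion assms by (intro choice) auto
  then obtain b where b: "\<And>i. (\<lambda>k. (1 / 2) ^ Suc k * of_bool (b i k)) sums z i" by blast
  obtain t where t: "0 \<le> t" "t \<le> 1"
    "\<And>j m. digit_reader (3 ^ m * (2 * real j + t)) = of_bool (case_prod b (prod_decode m))"
    using ternary_expansion[of "\<lambda>m. case_prod b (prod_decode m)"] by blast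
  have "schoenberg i (2 * real j + t) = z i" for i j
    using sums_unique[OF b[of i]] by (simp add: schoenberg_def t(3))
  with t that show thesis by blast
qed

text \<open>Coordinate 0 of Schoenberg's curve serves as a scaling factor that stretches the cube to the
  whole space. Its truncation at \<open>1 / (1 + \<bar>s\<bar>)\<close> avoids a pole; since Schoenberg's curve has
  period 2, every point can be reached at a parameter where the truncation is inactive.\<close>

lemma space_filling_curve:
  obtains G :: "real \<Rightarrow> real ^ 'n::finite" where
    "continuous_on UNIV G" "\<And>x. \<exists>s. G s = x \<and> \<bar>s\<bar> \<le> 2 * norm x + 7"
proof -
  obtain e :: "'n \<Rightarrow> nat" where e: "inj e"
    using finite_imp_inj_to_nat_seg[of "UNIV :: 'n set"] by auto
  define d where "d s = max (schoenberg 0 s) (1 / (1 + \<bar>s\<bar>))" for s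
  have d_pos: "d s > 0" for s
  proof -
    have "0 < 1 / (1 + \<bar>s\<bar>)" by (simp add: add_pos_nonneg)
    then show ?thesis by (simp add: d_def less_max_iff_disj)
  qed
  define G :: "real \<Rightarrow> real ^ 'n" where
    "G s = (\<chi> i. (2 * schoenberg (Suc (e i)) s - 1) / d s)" for s
  have "continuous_on UNIV d"
    unfolding d_def by (intro continuous_intros continuous_schoenberg) (auto simp: add_nonneg_eq_0_iff)
  moreover have "d s \<noteq> 0" for s using d_pos[of s] by simp
  ultimately have "continuous_on UNIV G"
    unfolding G_def by (intro continuous_intros continuous_schoenberg) auto
  moreover have "\<exists>s. G s = x \<and> \<bar>s\<bar> \<le> 2 * norm x + 7" for x
  proof -
    \<comment> \<open>\<open>norm x < k\<close> puts \<open>x / k\<close> into the open cube, and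
      \<open>k \<ge> 2\<close> keeps the scaling coordinate \<open>1 / k\<close> below 1.\<close>
    define k where "k = nat \<lceil>norm x\<rceil> + 2"
    have k: "norm x < k" "real k \<le> norm x + 3" "k \<ge> 2"
      using norm_ge_zero[of x] unfolding k_def by linarith+
    \<comment> \<open>Coordinate 0 carries the scale. Coordinate \<open>Suc (e i)\<close> carries
      \<open>x $ i / k\<close>, moved affinely from \<open>(-1, 1)\<close> to
      \<open>(0, 1)\<close>.\<close>
    define z where "z j = (case j of 0 \<Rightarrow> 1 / real k | Suc m \<Rightarrow>
      if m \<in> range e then (x $ inv e m / k + 1) / 2 else 0)" for j
    have "\<bar>x $ i\<bar> < k" for i using component_le_norm_cart[of x i] k by linarith
    then have "\<bar>x $ i / k\<bar> < 1" for i using k by simp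
    moreover have "0 \<le> (y + 1) / 2 \<and> (y + 1) / 2 < 1" if "\<bar>y\<bar> < 1" for y :: real
      using that by (auto simp: abs_less_iff)
    ultimately have "0 \<le> (x $ i / k + 1) / 2 \<and> (x $ i / k + 1) / 2 < 1" for i by blast
    then have "0 \<le> z j \<and> z j < 1" for j
      using k by (auto simp: z_def split: nat.split)
    then obtain t where t: "0 \<le> t" "t \<le> 1" "\<And>i j. schoenberg i (2 * real j + t) = z i"
      using schoenberg_surj[of z] by blast
    \<comment> \<open>Translation by \<open>2 * real k\<close> makes
      \<open>1 + \<bar>s\<bar>\<close> at least \<open>k\<close>, so the maximum in
      \<open>d s\<close> is \<open>1 / k\<close>.\<close>
    define s where "s = 2 * real k + t"
    have "1 / (1 + \<bar>s\<bar>) \<le> 1 / k"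
      using t k by (intro divide_left_mono) (auto simp: s_def)
    moreover have sch: "schoenberg i s = z i" for i by (simp add: s_def t)
    ultimately have ds: "d s = 1 / k" by (simp add: d_def z_def)
    have si: "schoenberg (Suc (e i)) s = (x $ i / k + 1) / 2" for i
      using e by (simp only: sch) (simp add: z_def)
    have "G s $ i = x $ i" for i
    proof -
      have "G s $ i = (2 * ((x $ i / k + 1) / 2) - 1) / (1 / k)"
        by (simp only: G_def vec_lambda_beta ds si)
      also have "\<dots> = x $ i" using k by (simp add: field_simps)
      finally show ?thesis .
    qed
    then have "G s = x" by (simp add: vec_eq_iff)
    moreover have "\<bar>s\<bar> \<le> 2 * norm x + 7" using t k by (simp add: s_def)
    ultimately show ?thesis by blast
  qed
  ultimately show thesis by (rule that)
qed

subsection \<open>Haviland's theorem\<close>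

text \<open>A probability measure whose squared distance to \<open>h\<close> is nearly minimal among the moment
  vectors is compared with its mixtures with point masses. This makes a polynomial nonnegative, and
  evaluating the functional there bounds the squared distance.\<close>

lemma approximate_moments:
  fixes h :: "nat ^ 'n::finite \<Rightarrow> real"
  assumes pos: "\<And>p. p \<in> POS \<Longrightarrow> 0 \<le> riesz h p"
    and h0: "h 0 = 1" and S: "finite S" and e: "\<epsilon> > 0"
  obtains p :: "(real ^ 'n) pmf" where "finite (set_pmf p)"
    "(\<Sum>\<alpha>\<in>S. (measure_pmf.expectation p (\<lambda>x. mpow x \<alpha>) - h \<alpha>)\<^sup>2) < \<epsilon>"
proof (rule ccontr)
  assume nt: "\<not> thesis"
  define D :: "(real ^ 'n) pmf \<Rightarrow> real" where
    "D p = (\<Sum>\<alpha>\<in>S. (measure_pmf.expectation p (\<lambda>x. mpow x \<alpha>) - h \<alpha>)\<^sup>2)" for p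
  let ?F = "{p :: (real ^ 'n) pmf. finite (set_pmf p)}"
  \<comment> \<open>If the claim fails, this infimum is at least \<open>\<epsilon>\<close>. The
    bound \<open>main\<close> will contradict its positivity.\<close>
  define \<delta> where "\<delta> = Inf (D ` ?F)"
  have D_ge: "\<And>p. p \<in> ?F \<Longrightarrow> \<epsilon> \<le> D p"
    using nt that unfolding D_def by (meson linorder_not_le mem_Collect_eq)
  have ne: "?F \<noteq> {}" by (auto intro!: exI[of _ "return_pmf 0"])
  have bdd: "bdd_below (D ` ?F)" using D_ge by (auto intro!: bdd_belowI)
  have "\<epsilon> \<le> \<delta>" unfolding \<delta>_def using ne D_ge by (intro cInf_greatest) auto
  have \<delta>_le: "\<delta> \<le> D p" if "finite (set_pmf p)" for p
    unfolding \<delta>_def using bdd that by (intro cInf_lower) auto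
  define K where "K = (\<Sum>\<alpha>\<in>S. h (\<alpha> + \<alpha>) - (h \<alpha>)\<^sup>2)"
  have main: "\<delta> \<le> t / 2 * (K + \<delta> + 2)" if t: "0 < t" "t \<le> 1" for t :: real
  proof -
    have "t\<^sup>2 > 0" using t by simp
    \<comment> \<open>\<open>t\<close> will be the weight of a point mass mixed into
      \<open>p\<close>; an excess below \<open>t\<^sup>2\<close> is of second order in it.\<close>
    then obtain p where p: "finite (set_pmf p)" "D p < \<delta> + t\<^sup>2"
      using cInf_lessD[of "D ` ?F" "\<delta> + t\<^sup>2"] ne unfolding \<delta>_def by auto
    define m where "m \<alpha> = measure_pmf.expectation p (\<lambda>x. mpow x \<alpha>)" for \<alpha>
    \<comment> \<open>Chosen so that \<open>2 * t * peval P x\<close> is \<open>t\<^sup>2\<close>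
      plus the change of \<open>D\<close> when \<open>p\<close> is mixed with the point mass at
      \<open>x\<close>.\<close>
    define P :: "'n mpoly" where "P = (\<Sum>\<alpha>\<in>S. Poly_Mapping.single \<alpha> (m \<alpha> - h \<alpha> - t * m \<alpha>) +
        Poly_Mapping.single 0 (t / 2 * (m \<alpha>)\<^sup>2 - (m \<alpha> - h \<alpha>) * m \<alpha>) +
        Poly_Mapping.single (\<alpha> + \<alpha>) (t / 2)) + Poly_Mapping.single 0 (t / 2)"
    have P: "riesz g P = (\<Sum>\<alpha>\<in>S. (m \<alpha> - h \<alpha>) * (g \<alpha> - m \<alpha> * g 0) +
        t / 2 * (g (\<alpha> + \<alpha>) - 2 * m \<alpha> * g \<alpha> + (m \<alpha>)\<^sup>2 * g 0)) + t / 2 * g 0" for g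
      by (simp add: P_def riesz_add riesz_sum algebra_simps power2_eq_square)
    have "0 \<le> peval P x" for x
    proof -
      define p' where "p' = bind_pmf (bernoulli_pmf t) (\<lambda>b. if b then return_pmf x else p)"
      have fin: "finite (set_pmf p')"
        using p by (auto simp: p'_def)
      have E: "measure_pmf.expectation p' f = t * f x + (1 - t) * measure_pmf.expectation p f"
        for f :: "real ^ 'n \<Rightarrow> real"
        unfolding p'_def using p t by (subst pmf_expectation_bind[of UNIV]) (auto simp: UNIV_bool)
      have "D p' = D p + (\<Sum>\<alpha>\<in>S. 2 * t * ((m \<alpha> - h \<alpha>) * (mpow x \<alpha> - m \<alpha>)) +
          t\<^sup>2 * (mpow x \<alpha> - m \<alpha>)\<^sup>2)"
        unfolding D_def E m_def[symmetric] sum.distrib[symmetric]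
        by (intro sum.cong refl) (simp add: power2_eq_square algebra_simps)
      also have "\<dots> = D p - t\<^sup>2 + 2 * t * peval P x"
        unfolding peval_eq_riesz P
        by (simp add: mpow_add sum_distrib_left power2_eq_square algebra_simps sum.distrib sum_subtractf)
      finally have "2 * t * peval P x > 0" using \<delta>_le[OF fin] p by linarith
      then show ?thesis using t by (simp add: zero_less_mult_iff)
    qed
    then have "0 \<le> riesz h P" by (intro pos) (simp add: POS_def)
    \<comment> \<open>Replacing the moments of the point mass by \<open>h\<close> turns the
      first-order term into \<open>- D p\<close>; everything else carries the factor
      \<open>t / 2\<close>.\<close>
    also have "riesz h P = (\<Sum>\<alpha>\<in>S. - (m \<alpha> - h \<alpha>)\<^sup>2 +
        t / 2 * ((h (\<alpha> + \<alpha>) - (h \<alpha>)\<^sup>2) + (m \<alpha> - h \<alpha>)\<^sup>2)) + t / 2"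
      unfolding P h0 by (simp add: power2_eq_square algebra_simps)
    also have "\<dots> = t / 2 * (K + D p + 1) - D p"
      unfolding sum.distrib sum_distrib_left[symmetric] sum_negf D_def m_def[symmetric] K_def
      by (simp add: algebra_simps)
    finally have "D p \<le> t / 2 * (K + D p + 1)" by simp
    moreover have "t\<^sup>2 \<le> 1" using t by (simp add: power_le_one)
    then have "t / 2 * (K + D p + 1) \<le> t / 2 * (K + \<delta> + 2)"
      using t p by (intro mult_left_mono) auto
    ultimately show ?thesis using \<delta>_le[OF p(1)] by linarith
  qed
  have "\<delta> > 0" using e \<open>\<epsilon> \<le> \<delta>\<close> by simp
  \<comment> \<open>With this weight the bound in \<open>main\<close> is at most
    \<open>\<delta> / 2\<close>.\<close>
  define t where "t = \<delta> / (\<bar>K\<bar> + \<delta> + 2)"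
  have pos': "\<bar>K\<bar> + \<delta> + 2 > 0" using \<open>\<delta> > 0\<close> by simp
  have "0 < t" "t \<le> 1" using \<open>\<delta> > 0\<close> pos' by (auto simp: t_def)
  then have "\<delta> \<le> t / 2 * (K + \<delta> + 2)" by (rule main)
  also have "\<dots> \<le> t / 2 * (\<bar>K\<bar> + \<delta> + 2)" using \<open>0 < t\<close> by (intro mult_left_mono) auto
  also have "\<dots> = t * (\<bar>K\<bar> + \<delta> + 2) / 2" by simp
  also have "t * (\<bar>K\<bar> + \<delta> + 2) = \<delta>" using pos' by (simp add: t_def)
  finally show False using \<open>\<delta> > 0\<close> by simp
qed

text \<open>Bounded second moments make \<open>f\<close> uniformly integrable: cutting it off at
  height \<open>K\<close> changes each expectation by at most \<open>C / K\<close>, and weak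
  convergence applies to the bounded cut-offs \<open>c K\<close>.\<close>

lemma weak_limit_expectation:
  fixes p :: "nat \<Rightarrow> (real ^ 'n::finite) pmf" and f :: "real ^ 'n \<Rightarrow> real"
  assumes fin: "\<And>k. finite (set_pmf (p k))"
    and M: "finite_measure M" "sets M = sets borel"
    and weak: "\<And>\<phi> :: real ^ 'n \<Rightarrow> real. continuous_on UNIV \<phi> \<Longrightarrow> bounded (range \<phi>) \<Longrightarrow>
      (\<lambda>k. measure_pmf.expectation (p k) \<phi>) \<longlonglongrightarrow> (\<integral>x. \<phi> x \<partial>M)"
    and f: "continuous_on UNIV f"
    and bd: "\<And>k. measure_pmf.expectation (p k) (\<lambda>x. (f x)\<^sup>2) \<le> C"
    and lim: "(\<lambda>k. measure_pmf.expectation (p k) f) \<longlonglongrightarrow> l"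
  shows "integrable M f" "(\<integral>x. f x \<partial>M) = l"
proof -
  interpret finite_measure M by fact
  note [simp] = integrable_measure_pmf_finite[OF fin]
  have [measurable]: "f \<in> borel_measurable M"
    using borel_measurable_continuous_onI[OF f] M(2) by (simp cong: measurable_cong_sets)
  define c where "c K x = max (- real K) (min (real K) (f x))" for K x
  have c_meas [measurable]: "c K \<in> borel_measurable M" for K
    unfolding c_def by measurable
  have c_le: "\<bar>c K x\<bar> \<le> \<bar>f x\<bar>" "\<bar>c K x\<bar> \<le> real K" for K x
    by (auto simp: c_def)
  have c_cont: "continuous_on UNIV (c K)" for K
    unfolding c_def by (intro continuous_intros f)
  have c_diff: "\<bar>f x - c K x\<bar> \<le> (f x)\<^sup>2 / K" if "K > 0" for K x
  proof (cases "\<bar>f x\<bar> \<le> K")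
    case False
    then have "\<bar>f x\<bar> * real K \<le> \<bar>f x\<bar> * \<bar>f x\<bar>" by (intro mult_left_mono) auto
    then have "\<bar>f x\<bar> \<le> (f x)\<^sup>2 / K" using that by (simp add: field_simps power2_eq_square)
    then show ?thesis using False by (auto simp: c_def)
  qed (auto simp: c_def)
  have c_tendsto: "(\<lambda>K. c K x) \<longlonglongrightarrow> f x" for x
  proof (rule tendsto_eventually)
    show "\<forall>\<^sub>F K in sequentially. c K x = f x"
      using eventually_ge_at_top[of "nat \<lceil>\<bar>f x\<bar>\<rceil>"]
    proof eventually_elim
      case (elim K)
      then have "\<bar>f x\<bar> \<le> real K" by linarith
      then show ?case by (auto simp: c_def)
    qed
  qed
  have c_lim: "(\<lambda>k. measure_pmf.expectation (p k) (c K)) \<longlonglongrightarrow> (\<integral>x. c K x \<partial>M)" for K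
    using c_le by (intro weak c_cont) (auto simp: bounded_iff intro!: exI[of _ "real K"])
  have abs_bd: "(\<integral>x. \<bar>c K x\<bar> \<partial>M) \<le> 1 + C" for K
  proof (rule LIMSEQ_le_const2)
    show "(\<lambda>k. measure_pmf.expectation (p k) (\<lambda>x. \<bar>c K x\<bar>)) \<longlonglongrightarrow> (\<integral>x. \<bar>c K x\<bar> \<partial>M)"
      using c_le by (intro weak continuous_intros c_cont) (auto simp: bounded_iff intro!: exI[of _ "real K"])
    have "measure_pmf.expectation (p k) (\<lambda>x. \<bar>c K x\<bar>) \<le> 1 + C" for k
    proof -
      have "\<bar>f x\<bar> \<le> 1 + (f x)\<^sup>2" for x
        using sum_squares_bound[of "\<bar>f x\<bar>" 1] by (simp add: power2_eq_square)
      then have "measure_pmf.expectation (p k) (\<lambda>x. \<bar>c K x\<bar>) \<le>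
          measure_pmf.expectation (p k) (\<lambda>x. 1 + (f x)\<^sup>2)"
        using c_le by (intro integral_mono) (simp_all, meson order_trans)
      also have "\<dots> \<le> 1 + C" using bd[of k] by simp
      finally show ?thesis .
    qed
    then show "\<exists>N. \<forall>n\<ge>N. measure_pmf.expectation (p n) (\<lambda>x. \<bar>c K x\<bar>) \<le> 1 + C" by blast
  qed
  have c_int: "integrable M (c K)" for K
    using c_le by (intro integrable_const_bound[of _ "real K"]) auto
  show int: "integrable M f"
  proof (rule integrableI_bounded)
    \<comment> \<open>Fatou's lemma along the cut-offs, whose absolute integrals are at most
      \<open>1 + C\<close>.\<close>
    have "(\<integral>\<^sup>+x. norm (f x) \<partial>M) = (\<integral>\<^sup>+x. liminf (\<lambda>K. ennreal \<bar>c K x\<bar>) \<partial>M)"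
    proof (intro nn_integral_cong)
      fix x
      have "(\<lambda>K. ennreal \<bar>c K x\<bar>) \<longlonglongrightarrow> ennreal \<bar>f x\<bar>"
        by (intro tendsto_ennrealI tendsto_rabs c_tendsto)
      then show "ennreal (norm (f x)) = liminf (\<lambda>K. ennreal \<bar>c K x\<bar>)"
        unfolding real_norm_def by (rule lim_imp_Liminf[OF sequentially_bot, symmetric])
    qed
    also have "\<dots> \<le> liminf (\<lambda>K. \<integral>\<^sup>+x. ennreal \<bar>c K x\<bar> \<partial>M)"
      by (intro nn_integral_liminf) measurable
    also have "\<dots> \<le> liminf (\<lambda>K :: nat. ennreal (1 + C))"
      using abs_bd c_int
      by (intro Liminf_mono always_eventually allI)
         (simp add: nn_integral_eq_integral ennreal_leI del: ennreal_plus)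
    also have "\<dots> < \<infinity>" by (simp add: Liminf_const)
    finally show "(\<integral>\<^sup>+x. norm (f x) \<partial>M) < \<infinity>" .
  qed measurable
  have lim1: "(\<lambda>K. \<integral>x. c K x \<partial>M) \<longlonglongrightarrow> (\<integral>x. f x \<partial>M)"
    using c_le c_tendsto by (intro integral_dominated_convergence[where w = "\<lambda>x. \<bar>f x\<bar>"] integrable_abs int) auto
  \<comment> \<open>The cut-off error is uniform in \<open>k\<close>, so it survives the limit in
    \<open>k\<close> for fixed \<open>K\<close>.\<close>
  have dist: "\<bar>l - (\<integral>x. c K x \<partial>M)\<bar> \<le> C / K" if "K > 0" for K
  proof (rule LIMSEQ_le_const2)
    show "(\<lambda>k. \<bar>measure_pmf.expectation (p k) f - measure_pmf.expectation (p k) (c K)\<bar>)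
        \<longlonglongrightarrow> \<bar>l - (\<integral>x. c K x \<partial>M)\<bar>"
      by (intro tendsto_intros lim c_lim)
    have "\<bar>measure_pmf.expectation (p k) f - measure_pmf.expectation (p k) (c K)\<bar> \<le> C / K" for k
    proof -
      have "\<bar>measure_pmf.expectation (p k) f - measure_pmf.expectation (p k) (c K)\<bar> =
          \<bar>measure_pmf.expectation (p k) (\<lambda>x. f x - c K x)\<bar>" by simp
      also have "\<dots> \<le> measure_pmf.expectation (p k) (\<lambda>x. \<bar>f x - c K x\<bar>)" by (rule integral_abs_bound)
      also have "\<dots> \<le> measure_pmf.expectation (p k) (\<lambda>x. (f x)\<^sup>2 / K)"
        using c_diff[OF that] by (intro integral_mono) simp_all
      also have "\<dots> \<le> C / K" using bd[of k] by (simp add: divide_right_mono)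
      finally show ?thesis .
    qed
    then show "\<exists>N. \<forall>k\<ge>N. \<bar>measure_pmf.expectation (p k) f - measure_pmf.expectation (p k) (c K)\<bar> \<le> C / K"
      by blast
  qed
  have "(\<lambda>K. C / real K) \<longlonglongrightarrow> 0" by (rule lim_const_over_n)
  moreover have "\<forall>\<^sub>F K in sequentially. norm (l - (\<integral>x. c K x \<partial>M)) \<le> C / real K"
    using eventually_gt_at_top[of 0] by eventually_elim (use dist in auto)
  ultimately have "(\<lambda>K. l - (\<integral>x. c K x \<partial>M)) \<longlonglongrightarrow> 0" by (rule Lim_null_comparison[rotated])
  then have "(\<lambda>K. l - (l - (\<integral>x. c K x \<partial>M))) \<longlonglongrightarrow> l - 0" by (intro tendsto_intros)
  then show "(\<integral>x. f x \<partial>M) = l" using lim1 LIMSEQ_unique by auto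
qed

section \<open>Haviland's theorem for normalised functionals\<close>

lemma continuous_mpow: "continuous_on A (\<lambda>x. mpow x \<alpha>)"
  unfolding mpow_def by (intro continuous_intros)

lemma haviland_prob:
  fixes h :: "nat ^ 'n::finite \<Rightarrow> real"
  assumes pos: "\<And>p. p \<in> POS \<Longrightarrow> 0 \<le> riesz h p" and h0: "h 0 = 1"
  shows "\<exists>M\<in>moment_measures. \<forall>\<alpha>. h \<alpha> = (\<integral>t. mpow t \<alpha> \<partial>M)"
proof -
  \<comment> \<open>The boxes exhaust all multi-indices, and the bound on the sum of squares leaves
    an error of at most \<open>1 / Suc k\<close> in each moment.\<close>
  have "\<exists>p :: (real ^ 'n) pmf. finite (set_pmf p) \<and>
      (\<Sum>\<alpha>\<in>{..\<chi> i. k}. (measure_pmf.expectation p (\<lambda>x. mpow x \<alpha>) - h \<alpha>)\<^sup>2) < (1 / Suc k)\<^sup>2" for k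
    by (rule approximate_moments[of h "{..\<chi> i. k}" "(1 / Suc k)\<^sup>2"])
       (use pos h0 in \<open>auto simp: finite_atMost_multiindex\<close>)
  then have "\<exists>p :: nat \<Rightarrow> (real ^ 'n) pmf. \<forall>k. finite (set_pmf (p k)) \<and>
      (\<Sum>\<alpha>\<in>{..\<chi> i. k}. (measure_pmf.expectation (p k) (\<lambda>x. mpow x \<alpha>) - h \<alpha>)\<^sup>2) < (1 / Suc k)\<^sup>2"
    by (intro choice allI)
  then obtain p :: "nat \<Rightarrow> (real ^ 'n) pmf" where fin: "\<And>k. finite (set_pmf (p k))"
    and p: "\<And>k. (\<Sum>\<alpha>\<in>{..\<chi> i. k}. (measure_pmf.expectation (p k) (\<lambda>x. mpow x \<alpha>) - h \<alpha>)\<^sup>2) < (1 / Suc k)\<^sup>2"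
    by blast
  note [simp] = integrable_measure_pmf_finite[OF fin]
  have mom: "(\<lambda>k. measure_pmf.expectation (p k) (\<lambda>x. mpow x \<alpha>)) \<longlonglongrightarrow> h \<alpha>" for \<alpha>
  proof (rule LIM_zero_cancel, rule Lim_null_comparison)
    show "\<forall>\<^sub>F k in sequentially. norm (measure_pmf.expectation (p k) (\<lambda>x. mpow x \<alpha>) - h \<alpha>) \<le> 1 / real (Suc k)"
      using eventually_ge_at_top[of "\<Sum>i\<in>UNIV. \<alpha> $ i"]
    proof eventually_elim
      case (elim k)
      have "\<alpha> $ i \<le> k" for i
        using member_le_sum[of i UNIV "($) \<alpha>"] elim by simp
      then have "\<alpha> \<in> {..\<chi> i. k}" by (simp add: less_eq_vec_def)
      then have "(measure_pmf.expectation (p k) (\<lambda>x. mpow x \<alpha>) - h \<alpha>)\<^sup>2 \<le>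
          (\<Sum>\<alpha>\<in>{..\<chi> i. k}. (measure_pmf.expectation (p k) (\<lambda>x. mpow x \<alpha>) - h \<alpha>)\<^sup>2)"
        by (intro member_le_sum finite_atMost_multiindex) auto
      also note p[of k]
      finally have "\<bar>measure_pmf.expectation (p k) (\<lambda>x. mpow x \<alpha>) - h \<alpha>\<bar> \<le> \<bar>1 / real (Suc k)\<bar>"
        by (simp only: abs_le_square_iff less_imp_le)
      then show ?case by simp
    qed
    show "(\<lambda>k. 1 / real (Suc k)) \<longlonglongrightarrow> 0"
      using LIMSEQ_inverse_real_of_nat by (simp add: inverse_eq_divide)
  qed
  obtain G :: "real \<Rightarrow> real ^ 'n" where G: "continuous_on UNIV G"
    "\<And>x. \<exists>s. G s = x \<and> \<bar>s\<bar> \<le> 2 * norm x + 7"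
    by (rule space_filling_curve) blast
  \<comment> \<open>A choice of preimages under \<open>G\<close>. Every function is measurable on
    \<open>measure_pmf\<close>, so \<open>p k\<close> can be pushed to the line by
    \<open>\<sigma>\<close>, and \<open>G\<close> brings it back.\<close>
  from G(2) obtain \<sigma> where \<sigma>: "\<And>x. G (\<sigma> x) = x" "\<And>x. \<bar>\<sigma> x\<bar> \<le> 2 * norm x + 7"
    by metis
  define \<nu> where "\<nu> k = distr (measure_pmf (p k)) borel \<sigma>" for k
  have \<nu>_real: "real_distribution (\<nu> k)" for k
    unfolding \<nu>_def by (rule prob_space.real_distribution_distr[OF measure_pmf.prob_space_axioms]) simp
  \<comment> \<open>This sum is the expectation of the squared norm.\<close>
  have "convergent (\<lambda>k. \<Sum>i\<in>UNIV. measure_pmf.expectation (p k) (\<lambda>x. mpow x (axis i 2)))"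
    by (rule convergentI, rule tendsto_sum, rule mom)
  from convergent_imp_Bseq[OF this] obtain B where "B > 0"
    "\<forall>k. norm (\<Sum>i\<in>UNIV. measure_pmf.expectation (p k) (\<lambda>x. mpow x (axis i 2))) \<le> B"
    by (rule BseqE)
  then have B: "B > 0"
    "\<And>k. norm (\<Sum>i\<in>UNIV. measure_pmf.expectation (p k) (\<lambda>x. mpow x (axis i 2))) \<le> B"
    by auto
  have \<sigma>_sq: "measure_pmf.expectation (p k) (\<lambda>x. (\<sigma> x)\<^sup>2) \<le> 8 * B + 98" for k
  proof -
    have "(\<sigma> x)\<^sup>2 \<le> 8 * (\<Sum>i\<in>UNIV. mpow x (axis i 2)) + 98" for x
    proof -
      have "(\<sigma> x)\<^sup>2 \<le> (2 * norm x + 7)\<^sup>2"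
        using \<sigma>(2)[of x] by (simp add: abs_le_square_iff[symmetric])
      also have "\<dots> \<le> 8 * (norm x)\<^sup>2 + 98"
        using sum_squares_bound[of "2 * norm x" 7] by (simp add: power2_sum power_mult_distrib)
      also have "(norm x)\<^sup>2 = (\<Sum>i\<in>UNIV. mpow x (axis i 2))"
        by (simp only: mpow_axis power2_norm_eq_inner inner_vec_def) (simp add: power2_eq_square)
      finally show ?thesis .
    qed
    then have "measure_pmf.expectation (p k) (\<lambda>x. (\<sigma> x)\<^sup>2) \<le>
        measure_pmf.expectation (p k) (\<lambda>x. 8 * (\<Sum>i\<in>UNIV. mpow x (axis i 2)) + 98)"
      by (intro integral_mono) auto
    also have "\<dots> \<le> 8 * B + 98" using B(2)[of k] by simp
    finally show ?thesis .
  qed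
  have "tight \<nu>"
    unfolding tight_def
  proof (intro conjI allI impI \<nu>_real)
    fix e :: real assume e: "e > 0"
    \<comment> \<open>Markov's inequality bounds the tail by \<open>(8 * B + 98) / R\<close>, which
      is below \<open>e\<close>. Since \<open>R > 1\<close>, \<open>(\<sigma> x)\<^sup>2 < R\<close>
      implies \<open>\<bar>\<sigma> x\<bar> < R\<close>.\<close>
    define R where "R = (8 * B + 99) / e + 1"
    have R: "R > 1" using e B by (simp add: R_def)
    have Re: "e * R = 8 * B + 99 + e" using e by (simp add: R_def field_simps)
    have "measure (\<nu> k) {- R<..R} > 1 - e" for k
    proof -
      have "measure_pmf.prob (p k) {x. (\<sigma> x)\<^sup>2 \<ge> R} \<le> measure_pmf.expectation (p k) (\<lambda>x. (\<sigma> x)\<^sup>2) / R"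
        using integral_Markov_inequality_measure[of "measure_pmf (p k)" "\<lambda>x. (\<sigma> x)\<^sup>2" UNIV R] R
        by simp
      also have "\<dots> \<le> (8 * B + 98) / R" using R \<sigma>_sq by (intro divide_right_mono) auto
      also have "\<dots> < e" using R e by (simp add: divide_less_eq Re)
      finally have small: "measure_pmf.prob (p k) {x. (\<sigma> x)\<^sup>2 \<ge> R} < e" .
      have "\<sigma> x \<in> {- R<..R}" if "(\<sigma> x)\<^sup>2 < R" for x
      proof -
        have "R \<le> R\<^sup>2" using R by (simp add: power2_eq_square)
        then have "(\<sigma> x)\<^sup>2 < R\<^sup>2" using that by simp
        then have "\<bar>\<sigma> x\<bar> < R" using R power2_less_imp_less[of "\<bar>\<sigma> x\<bar>" R] by simp
        then show ?thesis by auto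
      qed
      then have "measure_pmf.prob (p k) (UNIV - {x. (\<sigma> x)\<^sup>2 \<ge> R}) \<le> measure_pmf.prob (p k) (\<sigma> -` {- R<..R})"
        by (intro measure_pmf.finite_measure_mono) (auto simp: not_le)
      moreover have "measure_pmf.prob (p k) (UNIV - {x. (\<sigma> x)\<^sup>2 \<ge> R}) = 1 - measure_pmf.prob (p k) {x. (\<sigma> x)\<^sup>2 \<ge> R}"
        using measure_pmf.prob_compl[of "{x. (\<sigma> x)\<^sup>2 \<ge> R}" "p k"] by simp
      moreover have "measure (\<nu> k) {- R<..R} = measure_pmf.prob (p k) (\<sigma> -` {- R<..R})"
        by (simp add: \<nu>_def measure_distr)
      ultimately show ?thesis using small by linarith
    qed
    then show "\<exists>a b. a < b \<and> (\<forall>n. 1 - e < measure (\<nu> n) {a<..b})"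
      using R by (intro exI[of _ "- R"] exI[of _ R]) auto
  qed
  then obtain r N where r: "strict_mono r" and N: "real_distribution N"
    and conv: "weak_conv_m (\<nu> \<circ> id \<circ> r) N"
    using tight_imp_convergent_subsubsequence[OF _ strict_mono_id] by blast
  interpret N: real_distribution N by fact
  have G_meas [measurable]: "G \<in> borel_measurable borel"
    using G(1) by (rule borel_measurable_continuous_onI)
  define M where "M = distr N borel G"
  have M: "finite_measure M" "sets M = sets borel"
    by (auto simp: M_def intro!: N.finite_measure_distr)
  \<comment> \<open>Composition with \<open>G\<close> gives a bounded continuous test function on
    the line, and \<open>G (\<sigma> x) = x\<close> recovers the expectations under
    \<open>p (r k)\<close>.\<close>
  have weak: "(\<lambda>k. measure_pmf.expectation (p (r k)) \<phi>) \<longlonglongrightarrow> (\<integral>x. \<phi> x \<partial>M)"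
    if \<phi>: "continuous_on UNIV \<phi>" "bounded (range \<phi>)" for \<phi> :: "real ^ 'n \<Rightarrow> real"
  proof -
    obtain b where b: "\<And>x. norm (\<phi> x) \<le> b" using \<phi>(2) by (auto simp: bounded_iff)
    have [measurable]: "\<phi> \<in> borel_measurable borel"
      using \<phi>(1) by (rule borel_measurable_continuous_onI)
    have "continuous_on UNIV (\<lambda>s. \<phi> (G s))"
      by (rule continuous_on_compose2[OF \<phi>(1) G(1)]) auto
    then have cont: "isCont (\<lambda>s. \<phi> (G s)) s" for s
      by (simp add: continuous_on_eq_continuous_at)
    have "(\<lambda>k. integral\<^sup>L ((\<nu> \<circ> id \<circ> r) k) (\<lambda>s. \<phi> (G s))) \<longlonglongrightarrow> integral\<^sup>L N (\<lambda>s. \<phi> (G s))"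
      using \<nu>_real N conv cont b by (intro weak_conv_imp_integral_bdd_continuous_conv[where B = b]) (auto simp: o_def)
    then show ?thesis
      by (simp add: \<nu>_def M_def integral_distr \<sigma>)
  qed
  have lim: "(\<lambda>k. measure_pmf.expectation (p (r k)) (\<lambda>x. mpow x \<alpha>)) \<longlonglongrightarrow> h \<alpha>" for \<alpha>
    using LIMSEQ_subseq_LIMSEQ[OF mom r] by (simp add: o_def)
  have int: "integrable M (\<lambda>x. mpow x \<alpha>)" "(\<integral>x. mpow x \<alpha> \<partial>M) = h \<alpha>" for \<alpha>
  proof -
    \<comment> \<open>Moments of index \<open>\<alpha> + \<alpha>\<close> are expectations of
      squares; as they converge, they are bounded.\<close>
    obtain C where "\<forall>k. norm (measure_pmf.expectation (p (r k)) (\<lambda>x. mpow x (\<alpha> + \<alpha>))) \<le> C"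
      using convergent_imp_Bseq[OF convergentI[OF lim]] by (rule BseqE)
    then have "measure_pmf.expectation (p (r k)) (\<lambda>x. (mpow x \<alpha>)\<^sup>2) \<le> C" for k
      by (simp add: mpow_add power2_eq_square abs_le_iff)
    from weak_limit_expectation[where p = "\<lambda>k. p (r k)", OF fin M weak continuous_mpow this lim]
    show "integrable M (\<lambda>x. mpow x \<alpha>)" "(\<integral>x. mpow x \<alpha> \<partial>M) = h \<alpha>" by auto
  qed
  then have "M \<in> moment_measures"
    using M(2) by (auto simp: moment_measures_def integrable_iff_bounded)
  then show ?thesis using int by (intro bexI[of _ M]) auto
qed

section \<open>Removing the normalisation\<close>

lemma riesz_even_nonneg:
  assumes pos: "\<And>p. p \<in> POS \<Longrightarrow> 0 \<le> riesz h p"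
  shows "0 \<le> s\<^sup>2 * h (\<alpha> + \<alpha>) + 2 * s * h \<alpha> + h 0"
proof -
  let ?P = "Poly_Mapping.single (\<alpha> + \<alpha>) (s\<^sup>2) + Poly_Mapping.single \<alpha> (2 * s) + Poly_Mapping.single 0 1"
  have "peval ?P x = (s * mpow x \<alpha> + 1)\<^sup>2" for x
    by (simp add: peval_eq_riesz riesz_add mpow_add power2_eq_square algebra_simps)
  then have "0 \<le> riesz h ?P" by (intro pos) (simp add: POS_def)
  then show ?thesis by (simp add: riesz_add)
qed

text \<open>The Cauchy-Schwarz argument: a quadratic in \<open>s\<close> without constant term can
  stay nonnegative only if its linear term vanishes.\<close>

lemma riesz_eq_0:
  assumes pos: "\<And>p. p \<in> POS \<Longrightarrow> 0 \<le> riesz h p" and h0: "h 0 = 0"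
  shows "h \<alpha> = 0"
proof -
  let ?A = "h (\<alpha> + \<alpha>)"
  have q: "0 \<le> s\<^sup>2 * ?A + 2 * s * h \<alpha>" for s
    using riesz_even_nonneg[OF pos, of s \<alpha>] h0 by simp
  have A: "?A \<ge> 0" using q[of 1] q[of "- 1"] by simp
  \<comment> \<open>The quadratic becomes \<open>- s\<^sup>2 * (?A + 2)\<close>; the added 1 keeps
    the denominator positive when \<open>?A = 0\<close>.\<close>
  define s where "s = - h \<alpha> / (?A + 1)"
  have s: "h \<alpha> = - s * (?A + 1)" using A by (simp add: s_def)
  have "s\<^sup>2 * (?A + 2) \<le> 0"
    using q[of s] unfolding s by (simp add: power2_eq_square algebra_simps)
  then have "s = 0" using A by (auto simp: mult_le_0_iff)
  then show ?thesis using s by simp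
qed

text \<open>\<open>h 0\<close> is the total mass. If positive, divide by it and restore it as a
  constant density; if zero, \<open>h\<close> vanishes and the null measure represents it.\<close>

theorem haviland:
  fixes h :: "nat ^ 'n::finite \<Rightarrow> real"
  assumes pos: "\<And>p. p \<in> POS \<Longrightarrow> 0 \<le> riesz h p"
  shows "\<exists>M\<in>moment_measures. \<forall>\<alpha>. h \<alpha> = (\<integral>t. mpow t \<alpha> \<partial>M)"
proof (cases "h 0 = 0")
  case True
  have "null_measure (borel :: (real ^ 'n) measure) \<in> moment_measures"
    by (simp add: moment_measures_def null_measure_def[symmetric])
  then show ?thesis
    using riesz_eq_0[OF pos True] by (intro bexI[of _ "null_measure borel"]) simp_all
next
  case False
  have "0 \<le> riesz h (Poly_Mapping.single 0 1)"
    by (intro pos) (simp add: POS_def peval_eq_riesz)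
  with False have c: "h 0 > 0" by simp
  have "\<exists>M\<in>moment_measures. \<forall>\<alpha>. 1 / h 0 * h \<alpha> = (\<integral>t. mpow t \<alpha> \<partial>M)"
  proof (rule haviland_prob)
    show "0 \<le> riesz (\<lambda>\<alpha>. 1 / h 0 * h \<alpha>) p" if "p \<in> POS" for p
      unfolding riesz_cmult using pos[OF that] c by (intro mult_nonneg_nonneg) auto
    show "1 / h 0 * h 0 = 1" using c by simp
  qed
  then obtain M where M: "M \<in> moment_measures" "\<And>\<alpha>. 1 / h 0 * h \<alpha> = (\<integral>t. mpow t \<alpha> \<partial>M)"
    by blast
  have [measurable_cong]: "sets M = sets borel" using M(1) by (simp add: moment_measures_def)
  have [measurable]: "(\<lambda>t. mpow t \<alpha>) \<in> borel_measurable M" for \<alpha>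
    using borel_measurable_continuous_onI[OF continuous_mpow[of UNIV \<alpha>]] by measurable
  let ?M = "density M (\<lambda>_. ennreal (h 0))"
  have "?M \<in> moment_measures"
    using M(1) by (auto simp: moment_measures_def nn_integral_density nn_integral_cmult ennreal_mult_less_top)
  moreover have "h \<alpha> = (\<integral>t. mpow t \<alpha> \<partial>?M)" for \<alpha>
    using c M(2)[of \<alpha>] by (simp add: integral_density field_simps)
  ultimately show ?thesis by blast
qed

section \<open>From representing measures back to the operator\<close>

lemma integrable_mpow:
  assumes "M \<in> moment_measures"
  shows "integrable M (\<lambda>t. mpow t \<alpha>)"
proof (rule integrableI_bounded)
  show "(\<lambda>t. mpow t \<alpha>) \<in> borel_measurable M"
    using assms borel_measurable_continuous_onI[OF continuous_mpow[of UNIV \<alpha>]]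
    by (simp add: moment_measures_def cong: measurable_cong_sets)
qed (use assms in \<open>simp add: moment_measures_def\<close>)

lemma integral_peval:
  assumes "M \<in> moment_measures" "\<And>\<alpha>. h \<alpha> = (\<integral>t. mpow t \<alpha> \<partial>M)"
  shows "(\<integral>t. peval p t \<partial>M) = riesz h p"
  using assms by (simp add: peval_def riesz_def integrable_mpow)

lemma moment_family_iff:
  "(\<exists>\<mu>. moment_family q \<mu>) \<longleftrightarrow> (\<forall>y. \<forall>f\<in>POS. 0 \<le> riesz (hankel q y) f)"
proof
  assume "\<exists>\<mu>. moment_family q \<mu>"
  then obtain \<mu> where "\<And>y. \<mu> y \<in> moment_measures" "\<And>y \<alpha>. hankel q y \<alpha> = (\<integral>t. mpow t \<alpha> \<partial>(\<mu> y))"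
    by (auto simp: moment_family_def)
  then have "(\<integral>t. peval f t \<partial>(\<mu> y)) = riesz (hankel q y) f" for y f
    by (rule integral_peval)
  then have "riesz (hankel q y) f = (\<integral>t. peval f t \<partial>(\<mu> y))" for y f
    by simp
  then show "\<forall>y. \<forall>f\<in>POS. 0 \<le> riesz (hankel q y) f"
    by (simp add: POS_def)
next
  assume "\<forall>y. \<forall>f\<in>POS. 0 \<le> riesz (hankel q y) f"
  then have "\<forall>y. \<exists>M\<in>moment_measures. \<forall>\<alpha>. hankel q y \<alpha> = (\<integral>t. mpow t \<alpha> \<partial>M)"
    by (intro allI haviland) simp
  then obtain \<mu> where \<mu>: "\<And>y. \<mu> y \<in> moment_measures"
    "\<And>y \<alpha>. hankel q y \<alpha> = (\<integral>t. mpow t \<alpha> \<partial>(\<mu> y))"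
    by metis
  \<comment> \<open>The witness for the polynomial dependence of the moments on the
    parameter.\<close>
  have "hankel q y \<alpha> = peval (const (mfact \<alpha>) * q \<alpha>) y" for y \<alpha>
    by (simp add: hankel_def peval_mult)
  with \<mu> have "moment_family q \<mu>" unfolding moment_family_def by metis
  then show "\<exists>\<mu>. moment_family q \<mu>" by blast
qed

lemma frozen_op_convolution:
  assumes "moment_family q \<mu>"
  shows "peval (frozen_op q y f) x = (\<integral>t. peval f (t + x) \<partial>(\<mu> y))"
proof -
  have "(\<integral>t. peval (taylor x f) t \<partial>(\<mu> y)) = riesz (hankel q y) (taylor x f)"
    using assms by (intro integral_peval) (simp_all add: moment_family_def)
  then show ?thesis by (simp add: peval_taylor peval_frozen_op)
qed

text \<open>The quadratic form is the functional at the square of the polynomial with terms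
  \<open>v i\<close> times the monomial of exponent \<open>\<alpha> i\<close>.\<close>

lemma psd_hankel_kernelI:
  assumes pos: "\<And>p. p \<in> POS \<Longrightarrow> 0 \<le> riesz h p"
  shows "psd_hankel_kernel h"
  unfolding psd_hankel_kernel_def psd_matrix_def
proof (intro allI conjI ballI)
  fix m and \<alpha> :: "nat \<Rightarrow> nat ^ 'a" and v :: "nat \<Rightarrow> real"
  let ?P = "\<Sum>i=1..m. \<Sum>j=1..m. Poly_Mapping.single (\<alpha> i + \<alpha> j) (v i * v j)"
  have "peval ?P x = (\<Sum>i=1..m. v i * mpow x (\<alpha> i))\<^sup>2" for x
    by (simp add: peval_sum mpow_add power2_eq_square sum_product mult_ac)
  then have "0 \<le> riesz h ?P" by (intro pos) (simp add: POS_def)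
  then show "0 \<le> (\<Sum>i=1..m. \<Sum>j=1..m. v i * h (\<alpha> i + \<alpha> j) * v j)"
    by (simp add: riesz_sum mult_ac)
qed (simp add: add.commute)

theorem theorem3p1:
  fixes T :: "'n::finite mpoly \<Rightarrow> 'n mpoly"
    and q :: "nat ^ 'n \<Rightarrow> 'n mpoly"
  assumes "linear_operator T"
    and "T = diff_op q"
  shows
    "let A1 = (T ` POS \<subseteq> POS);
         A2 = (\<forall>y. frozen_op q y ` POS \<subseteq> POS);
         A3 = (\<forall>y \<alpha>. \<forall>f\<in>POS_deg (2 *s \<alpha>). 0 \<le> fischer (symbol_trunc q y (2 *s \<alpha>)) f);
         A3' = (\<forall>y \<alpha>. symbol_trunc q y (2 *s \<alpha>) \<in> dual_cone (POS_deg (2 *s \<alpha>)));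
         A4 = (\<exists>\<mu>. moment_family q \<mu>);
         A5 = (\<forall>y. psd_hankel_kernel (hankel q y))
     in (A1 \<longleftrightarrow> A2) \<and> (A2 \<longleftrightarrow> A3) \<and> (A3 \<longleftrightarrow> A3') \<and> (A3 \<longleftrightarrow> A4) \<and>
        (\<forall>\<mu>. moment_family q \<mu> \<longrightarrow>
           (\<forall>y f x. peval (frozen_op q y f) x = (\<integral>t. peval f (t + x) \<partial>(\<mu> y)))) \<and>
        (A1 \<or> A2 \<or> A3 \<or> A4 \<longrightarrow> A5)"
proof -
  \<comment> \<open>All conditions rewrite to nonnegativity of \<open>riesz (hankel q y)\<close> on
    \<open>POS\<close> for every \<open>y\<close>, so the equivalences become trivial.\<close>
  have "(\<forall>y \<alpha>. symbol_trunc q y (2 *s \<alpha>) \<in> dual_cone (POS_deg (2 *s \<alpha>))) \<longleftrightarrow>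
      (\<forall>y. \<forall>f\<in>POS. 0 \<le> riesz (hankel q y) f)"
    by (simp add: dual_cone_def flip: symbol_trunc_nonneg_iff)
  then show ?thesis
    unfolding Let_def assms(2) diff_op_POS_iff frozen_op_POS_iff symbol_trunc_nonneg_iff moment_family_iff
    using frozen_op_convolution psd_hankel_kernelI by blast
qed

end
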